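(* Let $\nu_0\in M_1(E)$, and let $\mathbf{0}=(0,0,\ldots)$ denote the origin in $\triangle_\infty$. As $\alpha$ and $\beta$ tend to infinity, $\mathbb{Z}_{\alpha,\beta}$ converges in probability to $\mathbf{0}$ (in $\triangle_\infty$ with the metric $d$) and $\Xi_{\alpha,\beta,\nu_0}$ converges in probability to $\nu_0$ (in $M_1(E)$ with the metric $\rho$).
   Context: $E=[0,1]$ with its Borel $\sigma$-algebra. $M_1(E)$ is the space of probability measures on $E$ with the weak topology and the metric $\rho(\mu,\nu)=\sum_{i=1}^\infty 2^{-i}\left(|\langle\mu-\nu,f_i\rangle|\wedge 1\right)$, where $\{f_i:i\ge1\}$ is a dense subset of $C(E)$ (continuous functions on $E$) and $\langle\mu,f\rangle=\int_E f\,d\mu$. $\triangle_\infty=\{\mathbf{p}=(p_1,p_2,\ldots)\in E^\infty:\sum_{i=1}^\infty p_i\le 1\}$, with the subspace topology of the product topology on $E^\infty$, generated by the metric $d(\mathbf{u},\mathbf{v})=\sum_{i=1}^\infty 2^{-i}(|u_i-v_i|\wedge 1)$. Let $\alpha>0$, $\beta>0$, $\nu_0\in M_1(E)$. Let $\xi_1,\xi_2,\ldots$ be i.i.d. with distribution $\nu_0$ and, independently, let $U_1,U_2,\ldots$ be i.i.d. with the Beta$(1,\alpha)$ distribution. Set $V_1=U_1$, $V_n=(1-U_1)\cdots(1-U_{n-1})U_n$ for $n\ge2$, and $\mathbb{V}_\alpha=(V_1,V_2,\ldots)$. Given $\mathbb{V}_\alpha$, let $W_1,W_2,\ldots$ be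 conditionally independent (and independent of the $\xi_i$), $W_n$ having the Beta$\left(\beta V_n,\ \beta(1-\sum_{k=1}^n V_k)\right)$ distribution. Set $Z_1=W_1$, $Z_n=(1-W_1)\cdots(1-W_{n-1})W_n$ for $n\ge2$, and $\mathbb{Z}_{\alpha,\beta}=(Z_1,Z_2,\ldots)$. The Dirichlet process with concentration parameter $\alpha$ and base distribution $\nu_0$ is $\Xi_{\alpha,\nu_0}=\sum_{i=1}^\infty V_i\delta_{\xi_i}$. The hierarchical Dirichlet process with level two concentration parameter $\beta$, level one concentration parameter $\alpha$ and base distribution $\nu_0$ is the random probability measure $\Xi_{\alpha,\beta,\nu_0}$ which, conditionally on $\Xi_{\alpha,\nu_0}$, is a Dirichlet process with concentration parameter $\beta$ and base distribution $\Xi_{\alpha,\nu_0}$; equivalently, in distribution, $\Xi_{\alpha,\beta,\nu_0}=\sum_{i=1}^\infty Z_i\delta_{\xi_i}$. *)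

theory Defs
  imports "HOL-Probability.Probability"
begin

text \<open>
  All sequences are indexed from 0; the weights 2^(-i), i \<ge> 1, become (1/2)^(i+1).
\<close>

definition unit_borel :: "real measure" where
  "unit_borel = restrict_space borel {0..1}"

text \<open>
  M_1(E) is the space of \<^term>\<open>prob_algebra unit_borel\<close>. Its sigma-algebra is generated by the
  evaluations, which is the Borel sigma-algebra of the weak topology.
\<close>

definition dense_in_C :: "(nat \<Rightarrow> real \<Rightarrow> real) \<Rightarrow> bool" where
  "dense_in_C f \<longleftrightarrow> (\<forall>i. continuous_on {0..1} (f i)) \<and>
     (\<forall>g. continuous_on {0..1} g \<longrightarrow>
        (\<forall>\<epsilon>>0. \<exists>i. \<forall>x\<in>{0..1}. \<bar>g x - f i x\<bar> < \<epsilon>))"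

definition rho :: "(nat \<Rightarrow> real \<Rightarrow> real) \<Rightarrow> real measure \<Rightarrow> real measure \<Rightarrow> real" where
  "rho f \<mu> \<nu> = (\<Sum>i. (1/2) ^ Suc i * min \<bar>(\<integral>x. f i x \<partial>\<mu>) - (\<integral>x. f i x \<partial>\<nu>)\<bar> 1)"

definition triangle_inf :: "(nat \<Rightarrow> real) set" where
  "triangle_inf = {p. (\<forall>i. p i \<in> {0..1}) \<and> summable p \<and> (\<Sum>i. p i) \<le> 1}"

definition dist_inf :: "(nat \<Rightarrow> real) \<Rightarrow> (nat \<Rightarrow> real) \<Rightarrow> real" where
  "dist_inf u v = (\<Sum>i. (1/2) ^ Suc i * min \<bar>u i - v i\<bar> 1)"

text \<open>
  Convergence in probability, along a filter, of random elements of \<open>S\<close> (with metric \<open>\<delta>\<close>) to a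
  point of \<open>S\<close>; the probability space may vary with the index. Measurability of the distance is
  part of the notion, since \<^const>\<open>measure\<close> is 0 on sets that are not measurable.
\<close>

definition converges_in_prob ::
    "'i filter \<Rightarrow> ('i \<Rightarrow> 'a measure) \<Rightarrow> 'b set \<Rightarrow> ('b \<Rightarrow> 'b \<Rightarrow> real) \<Rightarrow> ('i \<Rightarrow> 'a \<Rightarrow> 'b) \<Rightarrow> 'b \<Rightarrow> bool" where
  "converges_in_prob F M S \<delta> X x \<longleftrightarrow>
     x \<in> S \<and>
     (\<forall>\<^sub>F i in F. (AE \<omega> in M i. X i \<omega> \<in> S) \<and> (\<lambda>\<omega>. \<delta> (X i \<omega>) x) \<in> borel_measurable (M i)) \<and>
     (\<forall>\<epsilon>>0. ((\<lambda>i. measure (M i) {\<omega> \<in> space (M i). \<delta> (X i \<omega>) x > \<epsilon>}) \<longlongrightarrow> 0) F)"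

definition beta_dist :: "real \<Rightarrow> real \<Rightarrow> real measure" where
  "beta_dist a b = density lborel
     (\<lambda>x. ennreal (indicator {0..1} x * (x powr (a - 1) * (1 - x) powr (b - 1) / Beta a b)))"

definition stick :: "(nat \<Rightarrow> real) \<Rightarrow> nat \<Rightarrow> real" where
  "stick u n = (\<Prod>k<n. 1 - u k) * u n"

text \<open>
  The purely atomic measure with masses \<open>v n\<close> at the points \<open>x n\<close>. The masses used below form a
  probability vector only almost surely; on the exceptional null set the value is an arbitrary
  fixed probability measure, so that random measures are \<^term>\<open>prob_algebra unit_borel\<close>-valued
  everywhere.
\<close>

definition atomic :: "(nat \<Rightarrow> real) \<Rightarrow> (nat \<Rightarrow> real) \<Rightarrow> real measure" where
  "atomic v x =
     (if (\<forall>n. 0 \<le> v n) \<and> v sums 1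
      then measure_of (space unit_borel) (sets unit_borel)
             (\<lambda>A. \<Sum>n. ennreal (v n) * emeasure (return unit_borel (x n)) A)
      else return unit_borel 0)"

text \<open>The law, on M_1(E), of a Dirichlet process with concentration \<open>a\<close> and base distribution \<open>\<mu>\<close>.\<close>

definition dirichlet_process_law :: "real \<Rightarrow> real measure \<Rightarrow> real measure measure" where
  "dirichlet_process_law a \<mu> =
     distr ((\<Pi>\<^sub>M n\<in>(UNIV :: nat set). beta_dist 1 a) \<Otimes>\<^sub>M (\<Pi>\<^sub>M n\<in>(UNIV :: nat set). \<mu>))
           (prob_algebra unit_borel) (\<lambda>(u, x). atomic (stick u) x)"

text \<open>\<open>K\<close> is the conditional law of the \<open>T\<close>-valued \<open>X\<close> given the \<open>S\<close>-valued \<open>Y\<close>.\<close>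

definition has_cond_law ::
    "'a measure \<Rightarrow> 'c measure \<Rightarrow> ('a \<Rightarrow> 'c) \<Rightarrow> 'b measure \<Rightarrow> ('a \<Rightarrow> 'b) \<Rightarrow> ('b \<Rightarrow> 'c measure) \<Rightarrow> bool" where
  "has_cond_law M T X S Y K \<longleftrightarrow>
     X \<in> measurable M T \<and> Y \<in> measurable M S \<and>
     (\<forall>A\<in>sets T. AE \<omega> in M.
        real_cond_exp M (vimage_algebra (space M) Y S) (indicator (X -` A \<inter> space M)) \<omega>
          = measure (K (Y \<omega>)) A)"

abbreviation seq_borel :: "(nat \<Rightarrow> real) measure" where
  "seq_borel \<equiv> \<Pi>\<^sub>M n\<in>UNIV. borel"

text \<open>
  \<open>stick (\<lambda>k. U k \<omega>)\<close> is the sequence V, \<open>stick (\<lambda>k. W k \<omega>)\<close> the sequence Z. Given V the law of the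
  whole sequence W is a product measure, which expresses conditional independence. \<open>\<Xi>\<close> is the
  hierarchical Dirichlet process: given the Dirichlet process \<open>\<Xi>\<^sub>1\<close> with atoms \<open>\<xi>\<close> and masses V,
  it is a Dirichlet process with base distribution \<open>\<Xi>\<^sub>1\<close>.
\<close>

locale hierarchical_dirichlet = prob_space M
  for M :: "'a measure" +
  fixes \<alpha> \<beta> :: real and \<nu>\<^sub>0 :: "real measure"
    and \<xi> U W :: "nat \<Rightarrow> 'a \<Rightarrow> real"
    and \<Xi> :: "'a \<Rightarrow> real measure"
  assumes xi_indep: "indep_vars (\<lambda>_. unit_borel) \<xi> UNIV"
    and xi_law: "\<And>n. distr M unit_borel (\<xi> n) = \<nu>\<^sub>0"
    and U_indep: "indep_vars (\<lambda>_. borel) U UNIV"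
    and U_law: "\<And>n. distr M borel (U n) = beta_dist 1 \<alpha>"
    and xi_indep_U_W:
      "indep_set
         (sets (vimage_algebra (space M) (\<lambda>\<omega> n. \<xi> n \<omega>) (\<Pi>\<^sub>M n\<in>UNIV. unit_borel)))
         (sets (vimage_algebra (space M) (\<lambda>\<omega>. (\<lambda>n. U n \<omega>, \<lambda>n. W n \<omega>)) (seq_borel \<Otimes>\<^sub>M seq_borel)))"
    and W_cond_law:
      "has_cond_law M seq_borel (\<lambda>\<omega> n. W n \<omega>) seq_borel (\<lambda>\<omega>. stick (\<lambda>k. U k \<omega>))
         (\<lambda>v. \<Pi>\<^sub>M n\<in>UNIV. beta_dist (\<beta> * v n) (\<beta> * (1 - (\<Sum>k\<le>n. v k))))"
    and Xi_cond_law: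
      "has_cond_law M (prob_algebra unit_borel) \<Xi>
         (prob_algebra unit_borel) (\<lambda>\<omega>. atomic (stick (\<lambda>k. U k \<omega>)) (\<lambda>n. \<xi> n \<omega>))
         (dirichlet_process_law \<beta>)"

end

theory Submission
  imports Defs
begin

text \<open>
  Everything is an estimate of second moments. If \<open>v\<close> is a random
  probability vector independent of the i.i.d. points \<open>x n\<close> with law \<open>\<mu>\<close>, then the variance of
  \<open>\<Sum>n. v n * g (x n)\<close> is at most \<open>4 C\<^sup>2\<close> times the expectation of \<open>\<Sum>n. (v n)\<^sup>2\<close>, where \<open>C\<close> bounds \<open>g\<close>.
  For V this expectation is \<open>1 / (1 + \<alpha>)\<close>. Given V, the remainders \<open>\<Prod>k<n. 1 - W k\<close> have mean
  \<open>\<Prod>k<n. 1 - U k\<close>, so Z is almost surely a probability vector, and a telescoping product gives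
  \<open>Z n\<close> the second moment \<open>V n * (\<beta> * V n + 1) / (\<beta> + 1)\<close>; hence the expectation of \<open>\<Sum>n. (Z n)\<^sup>2\<close>
  is at most \<open>1 / (1 + \<alpha>) + 1 / (1 + \<beta>)\<close>. The random measure \<open>\<Xi>\<close> is handled by applying the variance
  estimate twice, to \<open>\<Xi>\<close> given \<open>\<Xi>\<^sub>1\<close> and to \<open>\<Xi>\<^sub>1\<close>. Chebyshev's inequality concludes.
\<close>

section \<open>Beta distributions and stick breaking\<close>

text \<open>Second moments suffice because both metrics are sums of truncated coordinates with
  geometric weights: up to a small tail only finitely many coordinates count, and each is controlled
  by its own variance. Nothing has to be uniform over the coordinates, so the bounds of the test
  functions may grow. The Beta parameters of W at position n add up to the second parameter at
  position n - 1. This is why the mean and the second moment of the remainders telescope although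
  the factors are not identically distributed. The obstacle is that W is given only by a conditional
  law, whose kernel is known to be a product of probability measures only when all
  \<open>U k\<close> lie strictly between 0 and 1. Hence estimates are made for a frozen realisation
  of U and then integrated, mostly in \<open>ennreal\<close>, where exchanging sums, products and
  integrals costs no integrability condition. Almost sure statements about W are obtained in the
  same way, from integrals of nonnegative functions.\<close>

lemma sets_beta_dist [simp, measurable_cong]: "sets (beta_dist a b) = sets borel"
  by (simp add: beta_dist_def)

lemma Beta_real_pos: "0 < a \<Longrightarrow> 0 < b \<Longrightarrow> 0 < Beta a (b::real)"
  by (simp add: Beta_def)

text \<open>Multiplying the density by \<open>x ^ p * (1 - x) ^ q\<close> only shifts the parameters
  of the Beta integral. The case p = q = 0 is the total mass; other small exponents give the moments
  used below.\<close>

lemma nn_integral_beta_dist: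
  fixes a b :: real
  assumes "0 < a" "0 < b"
  shows "(\<integral>\<^sup>+x. ennreal (x ^ p * (1 - x) ^ q) \<partial>beta_dist a b) = ennreal (Beta (a + p) (b + q) / Beta a b)"
proof -
  \<comment> \<open>The point 0 is split off because \<open>powr_realpow\<close> needs a positive
    base; there both sides vanish, as \<open>0 powr c\<close> is 0 for every c.\<close>
  have powr: "x powr (c - 1) * x ^ n = x powr (c + n - 1)" if "0 \<le> x" for x c :: real and n
    using that by (cases "x = 0") (simp_all add: powr_realpow[symmetric] powr_add[symmetric] algebra_simps)
  have *: "((\<lambda>t. inverse (Beta a b) * (t powr (a + p - 1) * (1 - t) powr (b + q - 1)))
      has_integral inverse (Beta a b) * Beta (a + p) (b + q)) {0..1}"
    using assms by (intro has_integral_mult_right has_integral_Beta_real) auto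
  have "(\<integral>\<^sup>+x. ennreal (x ^ p * (1 - x) ^ q) \<partial>beta_dist a b) =
    (\<integral>\<^sup>+x. indicator {0..1} x * ennreal (inverse (Beta a b) *
        (x powr (a + p - 1) * (1 - x) powr (b + q - 1))) \<partial>lborel)"
    unfolding beta_dist_def
    apply (subst nn_integral_density, measurable)
    apply (intro nn_integral_cong)
    using Beta_real_pos[OF assms]
    apply (auto simp: indicator_def ennreal_mult[symmetric] powr[symmetric] field_simps
        simp del: ennreal_mult')
    done
  also have "\<dots> = inverse (Beta a b) * Beta (a + p) (b + q)"
    using Beta_real_pos[OF assms] nn_integral_has_integral_lebesgue'[OF _ *]
    by (simp only: mult.commute[of "indicator {0..1} _"]) simp
  finally show ?thesis by (simp add: field_simps)
qed

lemma Beta_add_one_right: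
  fixes a b :: real
  assumes "0 < a" "0 < b"
  shows "Beta a (b + 1) = b / (a + b) * Beta a b"
  using Beta_plus1_right[of b a] assms by (auto simp: field_simps nonpos_Ints_def)

lemma Beta_add_one_left:
  fixes a b :: real
  assumes "0 < a" "0 < b"
  shows "Beta (a + 1) b = a / (a + b) * Beta a b"
  using Beta_plus1_left[of a b] assms by (auto simp: field_simps nonpos_Ints_def)

lemma
  fixes a b :: real
  assumes "0 < a" "0 < b"
  shows prob_space_beta_dist: "prob_space (beta_dist a b)"
    and nn_integral_beta_dist_compl:
      "(\<integral>\<^sup>+x. ennreal (1 - x) \<partial>beta_dist a b) = ennreal (b / (a + b))"
    and nn_integral_beta_dist_compl_square:
      "(\<integral>\<^sup>+x. ennreal ((1 - x)\<^sup>2) \<partial>beta_dist a b)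
        = ennreal (b * (b + 1) / ((a + b) * (a + b + 1)))"
    and nn_integral_beta_dist_square:
      "(\<integral>\<^sup>+x. ennreal (x\<^sup>2) \<partial>beta_dist a b) = ennreal (a * (a + 1) / ((a + b) * (a + b + 1)))"
proof -
  have B: "Beta a b > 0" using Beta_real_pos[OF assms] .
  show "prob_space (beta_dist a b)"
    using nn_integral_beta_dist[OF assms, of 0 0] B by (intro prob_spaceI) simp
  show "(\<integral>\<^sup>+x. ennreal (1 - x) \<partial>beta_dist a b) = ennreal (b / (a + b))"
    using nn_integral_beta_dist[OF assms, of 0 1] B Beta_add_one_right[OF assms]
    by simp
  have "Beta a (b + 2) = (b + 1) / (a + b + 1) * (b / (a + b) * Beta a b)"
    using Beta_add_one_right[of a "b + 1"] Beta_add_one_right[of a b] assms by (simp add: add_ac)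
  then show "(\<integral>\<^sup>+x. ennreal ((1 - x)\<^sup>2) \<partial>beta_dist a b)
        = ennreal (b * (b + 1) / ((a + b) * (a + b + 1)))"
    using nn_integral_beta_dist[OF assms, of 0 2] B
    by (simp add: mult.commute)
  have "Beta (a + 2) b = (a + 1) / (a + b + 1) * (a / (a + b) * Beta a b)"
    using Beta_add_one_left[of "a + 1" b] Beta_add_one_left[of a b] assms by (simp add: add_ac)
  then show "(\<integral>\<^sup>+x. ennreal (x\<^sup>2) \<partial>beta_dist a b) = ennreal (a * (a + 1) / ((a + b) * (a + b + 1)))"
    using nn_integral_beta_dist[OF assms, of 2 0] B
    by (simp add: mult.commute)
qed

text \<open>The density itself vanishes off the open interval: outside by the indicator, at the two
  endpoints because \<open>0 powr c\<close> is 0.\<close>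

lemma AE_beta_dist: "AE x in beta_dist a b. 0 < x \<and> x < 1"
  unfolding beta_dist_def
  apply (subst AE_density, measurable)
  apply (rule AE_I2)
  subgoal for x by (cases "x = 0"; cases "x = 1") (auto simp: indicator_def split: if_splits)
  done

text \<open>The coordinate family is the identity map of the product space and has the marginals
  \<open>B i\<close>, so its joint law is the product of its marginals.\<close>

lemma indep_vars_PiM_coordinates:
  assumes B: "\<And>i. prob_space (B i)"
  shows "prob_space.indep_vars (PiM UNIV B) B (\<lambda>i x. x i) UNIV"
proof -
  interpret P: prob_space "PiM UNIV B" by (intro prob_space_PiM B)
  have "distr (PiM UNIV B) (PiM UNIV B) (\<lambda>x. \<lambda>i\<in>UNIV. x i) = PiM UNIV (\<lambda>i. distr (PiM UNIV B) (B i) (\<lambda>x. x i))"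
    by (subst distr_PiM_component[OF B]) (simp_all add: restrict_def distr_id)
  then show ?thesis
    by (subst P.indep_vars_iff_distr_eq_PiM) auto
qed

text \<open>Moments of stick-breaking weights are integrals of such products; with values in
  \<open>ennreal\<close> no integrability of the factors has to be checked.\<close>

lemma nn_integral_PiM_prod:
  fixes B :: "'i \<Rightarrow> 'b measure" and h :: "'i \<Rightarrow> 'b \<Rightarrow> ennreal"
  assumes B: "\<And>i. prob_space (B i)" and h: "\<And>i. h i \<in> borel_measurable (B i)" and "finite I"
  shows "(\<integral>\<^sup>+w. (\<Prod>i\<in>I. h i (w i)) \<partial>PiM UNIV B) = (\<Prod>i\<in>I. \<integral>\<^sup>+x. h i x \<partial>B i)"
proof -
  interpret P: prob_space "PiM UNIV B" by (intro prob_space_PiM B)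
  have "P.indep_vars B (\<lambda>i x. x i) UNIV"
    by (rule indep_vars_PiM_coordinates[OF B])
  then have "P.indep_vars (\<lambda>_. borel) (\<lambda>i x. h i (x i)) UNIV"
    by (rule P.indep_vars_compose2) (use h in auto)
  then have "P.indep_vars (\<lambda>_. borel) (\<lambda>i x. h i (x i)) I"
    by (rule P.indep_vars_subset) auto
  then have "(\<integral>\<^sup>+w. (\<Prod>i\<in>I. h i (w i)) \<partial>PiM UNIV B) = (\<Prod>i\<in>I. \<integral>\<^sup>+w. h i (w i) \<partial>PiM UNIV B)"
    by (intro P.indep_vars_nn_integral) (use \<open>finite I\<close> in auto)
  also have "\<dots> = (\<Prod>i\<in>I. \<integral>\<^sup>+x. h i x \<partial>B i)"
  proof (intro prod.cong refl)
    fix i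
    have "(\<integral>\<^sup>+x. h i x \<partial>B i) = (\<integral>\<^sup>+x. h i x \<partial>distr (PiM UNIV B) (B i) (\<lambda>x. x i))"
      by (subst distr_PiM_component[OF B]) auto
    also have "\<dots> = (\<integral>\<^sup>+w. h i (w i) \<partial>PiM UNIV B)"
      using h by (subst nn_integral_distr) auto
    finally show "(\<integral>\<^sup>+w. h i (w i) \<partial>PiM UNIV B) = (\<integral>\<^sup>+x. h i x \<partial>B i)" ..
  qed
  finally show ?thesis .
qed

section \<open>Stick breaking with arbitrary and with independent fractions\<close>

lemma sum_stick: "(\<Sum>i<n. stick u i) = 1 - (\<Prod>k<n. 1 - u k)"
  by (induction n) (auto simp: stick_def algebra_simps)

lemma stick_nonneg: "(\<And>k. 0 \<le> u k \<and> u k \<le> 1) \<Longrightarrow> 0 \<le> stick u n"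
  by (auto simp: stick_def intro!: mult_nonneg_nonneg prod_nonneg)

lemma measurable_stick [measurable]: "stick \<in> seq_borel \<rightarrow>\<^sub>M seq_borel"
proof -
  have "(\<lambda>u n. (\<Prod>k<n. 1 - u k) * u n) \<in> seq_borel \<rightarrow>\<^sub>M seq_borel"
    by (rule measurable_PiM_single') (auto simp: space_PiM)
  then show ?thesis unfolding stick_def[abs_def] .
qed

lemma stick_in_triangle_inf:
  assumes u: "\<And>k. 0 \<le> u k \<and> u k \<le> 1"
  shows "stick u \<in> triangle_inf"
proof -
  have nn: "0 \<le> stick u i" for i using u by (rule stick_nonneg)
  have le: "(\<Sum>i<n. stick u i) \<le> 1" for n
    using u by (auto simp: sum_stick intro!: prod_nonneg)
  have "summable (stick u)"
    by (rule bounded_imp_summable[where B=1, OF nn]) (metis le lessThan_Suc_atMost)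
  moreover have "stick u i \<le> 1" for i
    using le[of "Suc i"] sum_nonneg[of "{..<i}" "stick u"] nn by simp
  ultimately show ?thesis
    using nn le by (auto simp: triangle_inf_def intro: suminf_le_const)
qed

text \<open>This is the test inside \<open>atomic\<close>; unfolding both decides which branch is
  taken.\<close>

definition prob_vector :: "(nat \<Rightarrow> real) \<Rightarrow> bool" where
  "prob_vector v \<longleftrightarrow> (\<forall>n. 0 \<le> v n) \<and> v sums 1"

text \<open>The pieces cut off so far add up to 1 minus the remainder, so the total mass is 1 as
  soon as the remainders tend to 0; their summability forces this.\<close>

lemma prob_vector_stick:
  assumes u: "\<And>k. 0 \<le> u k \<and> u k \<le> 1" and fin: "(\<Sum>n. ennreal (\<Prod>k<n. 1 - u k)) \<noteq> top"
  shows "prob_vector (stick u)"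
proof -
  have "summable (\<lambda>n. \<Prod>k<n. 1 - u k)"
    using u fin by (intro summable_suminf_not_top prod_nonneg) auto
  then have "(\<lambda>n. 1 - (\<Prod>k<n. 1 - u k)) \<longlonglongrightarrow> 1 - 0"
    by (intro tendsto_diff tendsto_const summable_LIMSEQ_zero)
  then show ?thesis
    using stick_nonneg[of u] u by (simp add: prob_vector_def sums_def sum_stick)
qed

lemma AE_prob_vector_stick:
  assumes sets: "sets N = sets seq_borel"
    and u: "AE u in N. \<forall>k. 0 \<le> u k \<and> u k \<le> 1"
    and fin: "(\<integral>\<^sup>+u. (\<Sum>n. ennreal (\<Prod>k<n. 1 - u k)) \<partial>N) \<noteq> top"
  shows "AE u in N. prob_vector (stick u)"
proof -
  have [measurable_cong]: "sets N = sets seq_borel" by fact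
  have "AE u in N. (\<Sum>n. ennreal (\<Prod>k<n. 1 - u k)) \<noteq> \<infinity>"
  proof (rule nn_integral_noteq_infinite)
    show "(\<lambda>u. \<Sum>n. ennreal (\<Prod>k<n. 1 - u k)) \<in> borel_measurable N"
      by measurable
  qed (use fin in simp)
  with u show ?thesis
    by eventually_elim (auto intro!: prob_vector_stick)
qed

text \<open>The factors may differ from each other: besides the constant family of level one this
  covers the factors of W for a frozen V.\<close>

locale unit_factors =
  fixes B :: "nat \<Rightarrow> real measure"
  assumes prob: "\<And>n. prob_space (B n)" and sets: "\<And>n. sets (B n) = sets borel"
    and unit: "\<And>n. AE x in B n. 0 < x \<and> x < 1"
begin

sublocale P: prob_space "PiM UNIV B"
  by (intro prob_space_PiM prob)

lemma sets_PiM: "sets (PiM UNIV B) = sets seq_borel"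
  by (intro sets_PiM_cong refl sets)

lemma AE_unit: "AE w in PiM UNIV B. \<forall>k. 0 < w k \<and> w k < 1"
  unfolding AE_all_countable
  by (intro allI AE_PiM_component[where P="\<lambda>x. 0 < x \<and> x < 1"] prob unit) simp

lemma nn_integral_remainder:
  "(\<integral>\<^sup>+w. ennreal (\<Prod>k<n. 1 - w k) \<partial>PiM UNIV B) = (\<Prod>k<n. \<integral>\<^sup>+x. ennreal (1 - x) \<partial>B k)"
proof -
  \<comment> \<open>\<open>ennreal\<close> sends negative numbers to 0, so it is moved inside the
    product only where all \<open>1 - w k\<close> are nonnegative, which is almost
    everywhere.\<close>
  have "(\<integral>\<^sup>+w. ennreal (\<Prod>k<n. 1 - w k) \<partial>PiM UNIV B)
      = (\<integral>\<^sup>+w. (\<Prod>k<n. ennreal (1 - w k)) \<partial>PiM UNIV B)"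
    using AE_unit by (intro nn_integral_cong_AE) (auto simp: prod_ennreal less_imp_le elim!: eventually_mono)
  also have "\<dots> = (\<Prod>k<n. \<integral>\<^sup>+x. ennreal (1 - x) \<partial>B k)"
    by (intro nn_integral_PiM_prod prob) (auto simp: measurable_cong_sets[OF sets refl])
  finally show ?thesis .
qed

lemma nn_integral_stick_square:
  "(\<integral>\<^sup>+w. ennreal ((stick w n)\<^sup>2) \<partial>PiM UNIV B)
    = (\<Prod>k<n. \<integral>\<^sup>+x. ennreal ((1 - x)\<^sup>2) \<partial>B k) * (\<integral>\<^sup>+x. ennreal (x\<^sup>2) \<partial>B n)"
proof -
  \<comment> \<open>A single family of functions, with the last index singled out, makes the square
    of \<open>stick w n\<close> one product over \<open>k < Suc n\<close>.\<close>
  define h where "h k x = ennreal (if k < n then (1 - x)\<^sup>2 else x\<^sup>2)" for k and x :: real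
  have "(\<integral>\<^sup>+w. ennreal ((stick w n)\<^sup>2) \<partial>PiM UNIV B) = (\<integral>\<^sup>+w. (\<Prod>k<Suc n. h k (w k)) \<partial>PiM UNIV B)"
    by (intro nn_integral_cong)
       (simp add: h_def stick_def power_mult_distrib ennreal_mult prod_ennreal prod_power_distrib prod_nonneg)
  also have "\<dots> = (\<Prod>k<Suc n. \<integral>\<^sup>+x. h k x \<partial>B k)"
    by (intro nn_integral_PiM_prod prob) (auto simp: h_def measurable_cong_sets[OF sets refl])
  finally show ?thesis by (simp add: h_def)
qed

end

lemma unit_factors_beta_dist:
  "(\<And>n. 0 < a n) \<Longrightarrow> (\<And>n. 0 < b n) \<Longrightarrow> unit_factors (\<lambda>n. beta_dist (a n) (b n))"
  by (intro unit_factors.intro prob_space_beta_dist AE_beta_dist sets_beta_dist)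

lemma suminf_ennreal_geometric:
  assumes "0 \<le> c" "0 \<le> q" "q < 1"
  shows "(\<Sum>n. ennreal (c * q ^ n)) = ennreal (c / (1 - q))"
  using assms sums_mult[OF geometric_sums[of q], of c] by (intro suminf_ennreal_eq) auto

lemma remainder_sum_iid:
  assumes "0 < a"
  shows "(\<integral>\<^sup>+w. (\<Sum>n. ennreal (\<Prod>k<n. 1 - w k)) \<partial>PiM UNIV (\<lambda>_::nat. beta_dist 1 a)) = ennreal (1 + a)"
proof -
  interpret unit_factors "\<lambda>_. beta_dist 1 a" using assms by (intro unit_factors_beta_dist) auto
  have "(\<integral>\<^sup>+w. (\<Sum>n. ennreal (\<Prod>k<n. 1 - w k)) \<partial>PiM UNIV (\<lambda>_::nat. beta_dist 1 a))
     = (\<Sum>n. ennreal (1 * (a / (1 + a)) ^ n))"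
    using assms by (simp add: nn_integral_suminf nn_integral_remainder nn_integral_beta_dist_compl
        prod_constant ennreal_power)
  also have "\<dots> = ennreal (1 + a)"
    using assms by (subst suminf_ennreal_geometric) (auto simp: field_simps)
  finally show ?thesis .
qed

text \<open>The second moments form a geometric sequence: \<open>(1 - w k)\<^sup>2\<close> has mean
  \<open>a / (a + 2)\<close> and \<open>(w n)\<^sup>2\<close> has mean
  \<open>2 / ((1 + a) * (a + 2))\<close>. The sum is the probability that two draws from the random
  weights hit the same index.\<close>

lemma stick_square_iid:
  assumes "0 < a"
  shows "(\<integral>\<^sup>+w. (\<Sum>n. ennreal ((stick w n)\<^sup>2)) \<partial>PiM UNIV (\<lambda>_::nat. beta_dist 1 a)) = ennreal (1 / (1 + a))"
proof -
  interpret unit_factors "\<lambda>_. beta_dist 1 a" using assms by (intro unit_factors_beta_dist) auto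
  have "(\<integral>\<^sup>+w. (\<Sum>n. ennreal ((stick w n)\<^sup>2)) \<partial>PiM UNIV (\<lambda>_::nat. beta_dist 1 a))
     = (\<Sum>n. \<integral>\<^sup>+w. ennreal ((stick w n)\<^sup>2) \<partial>PiM UNIV (\<lambda>_::nat. beta_dist 1 a))"
    by (subst nn_integral_suminf) auto
  also have "\<dots> = (\<Sum>n. ennreal (2 / ((1 + a) * (a + 2)) * (a / (a + 2)) ^ n))"
  proof (intro suminf_cong)
    fix n
    have *: "a * (a + 1) / ((1 + a) * (1 + a + 1)) = a / (a + 2)" using assms by (simp add: divide_simps add_ac)
    show "(\<integral>\<^sup>+w. ennreal ((stick w n)\<^sup>2) \<partial>PiM UNIV (\<lambda>_::nat. beta_dist 1 a))
        = ennreal (2 / ((1 + a) * (a + 2)) * (a / (a + 2)) ^ n)"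
      unfolding nn_integral_stick_square using assms
      by (simp add: nn_integral_beta_dist_square nn_integral_beta_dist_compl_square * ennreal_power
          ennreal_mult[symmetric] add_ac mult_ac)
  qed
  also have "\<dots> = ennreal (1 / (1 + a))"
  proof (subst suminf_ennreal_geometric)
    have "1 - a / (a + 2) = 2 / (a + 2)" using assms by (simp add: field_simps)
    moreover have "2 / ((1 + a) * (a + 2)) / (2 / (a + 2)) = 1 / (1 + a)" using assms by (simp add: divide_simps)
    ultimately show "ennreal (2 / ((1 + a) * (a + 2)) / (1 - a / (a + 2))) = ennreal (1 / (1 + a))"
      by simp
  qed (use assms in auto)
  finally show ?thesis .
qed

section \<open>Level two for a frozen realisation of level one\<close>

text \<open>Here \<open>u\<close> stands for a realisation of U and \<open>b\<close> for \<beta>.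
  Fractions strictly inside the unit interval keep all pieces and remainders positive, hence also
  all Beta parameters.\<close>

locale stick_conditional =
  fixes u :: "nat \<Rightarrow> real" and b :: real
  assumes u: "\<And>k. 0 < u k \<and> u k < 1" and b: "0 < b"
begin

definition rem :: "nat \<Rightarrow> real" where "rem n = (\<Prod>k<n. 1 - u k)"
abbreviation B :: "nat \<Rightarrow> real measure" where
  "B n \<equiv> beta_dist (b * stick u n) (b * (1 - (\<Sum>k\<le>n. stick u k)))"

lemma rem_pos: "0 < rem n"
  unfolding rem_def using u by (intro prod_pos) auto

lemma stick_pos: "0 < stick u n"
  using u rem_pos[of n] by (simp add: stick_def rem_def)

lemma rem_Suc: "rem (Suc n) = rem n * (1 - u n)" and stick_eq: "stick u n = rem n * u n"
  by (simp_all add: rem_def stick_def)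

text \<open>The sum up to and including n leaves the stick after n + 1 cuts, hence
  \<open>Suc n\<close>. The two parameters then add up to \<open>b * rem n\<close>, the source of
  all telescoping below.\<close>

lemma B_eq: "B n = beta_dist (b * stick u n) (b * rem (Suc n))"
  using sum_stick[of u "Suc n"] by (simp add: rem_def lessThan_Suc_atMost)

lemma beta_params: "0 < b * stick u n" "0 < b * rem (Suc n)"
  "b * stick u n + b * rem (Suc n) = b * rem n"
  using b stick_pos rem_pos u by (auto simp: stick_eq rem_Suc algebra_simps)

sublocale unit_factors B
  unfolding B_eq using beta_params by (intro unit_factors_beta_dist) auto

text \<open>The mean of \<open>1 - w k\<close> is the second Beta parameter over the sum of both,
  \<open>rem (Suc k) / rem k\<close>; \<beta> cancels and \<open>1 - u k\<close> is left.\<close>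

lemma remainder: "(\<integral>\<^sup>+w. ennreal (\<Prod>k<n. 1 - w k) \<partial>PiM UNIV B) = ennreal (\<Prod>k<n. 1 - u k)"
proof -
  have "b * rem (Suc k) / (b * rem k) = 1 - u k" for k
    using b rem_pos[of k] by (simp add: rem_Suc)
  then have "(\<integral>\<^sup>+x. ennreal (1 - x) \<partial>B k) = ennreal (1 - u k)" for k
    unfolding B_eq using beta_params[of k] by (simp only: nn_integral_beta_dist_compl)
  then show ?thesis
    using u by (simp only: nn_integral_remainder) (simp add: prod_ennreal less_imp_le)
qed

text \<open>One telescoping step: with m(x) = x (b x + 1) / (b + 1), the second factor is m(y) /
  m(x). It is used with y the next remainder, and once more with y the piece cut off last.\<close>

lemma second_moment_ratio:
  assumes "0 < x" "0 \<le> y"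
  shows "ennreal (x * (b * x + 1) / (b + 1)) * ennreal (b * y * (b * y + 1) / (b * x * (b * x + 1)))
    = ennreal (y * (b * y + 1) / (b + 1))"
proof -
  have pos: "b * x + 1 > 0" using b assms by (simp add: add_pos_pos)
  have "ennreal (x * (b * x + 1) / (b + 1)) * ennreal (b * y * (b * y + 1) / (b * x * (b * x + 1)))
      = ennreal (x * (b * x + 1) / (b + 1) * (b * y * (b * y + 1) / (b * x * (b * x + 1))))"
    using b assms by (intro ennreal_mult[symmetric]) auto
  also have "x * (b * x + 1) / (b + 1) * (b * y * (b * y + 1) / (b * x * (b * x + 1))) = y * (b * y + 1) / (b + 1)"
    using b assms pos by (simp add: divide_simps)
  finally show ?thesis .
qed

text \<open>The factor at n is the quotient of the right-hand expression at
  \<open>rem (Suc n)\<close> by that at \<open>rem n\<close>; the denominator \<open>b + 1\<close>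
  makes the expression 1 at the start, where \<open>rem 0 = 1\<close>.\<close>

lemma prod_compl_square:
  "(\<Prod>k<n. \<integral>\<^sup>+x. ennreal ((1 - x)\<^sup>2) \<partial>B k) = ennreal (rem n * (b * rem n + 1) / (b + 1))"
proof (induction n)
  case 0
  then show ?case using b by (simp add: rem_def)
next
  case (Suc n)
  have "(\<integral>\<^sup>+x. ennreal ((1 - x)\<^sup>2) \<partial>B n)
      = ennreal (b * rem (Suc n) * (b * rem (Suc n) + 1) / (b * rem n * (b * rem n + 1)))"
    unfolding B_eq using beta_params[of n] by (simp only: nn_integral_beta_dist_compl_square)
  then show ?case
    using Suc second_moment_ratio[OF rem_pos[of n], of "rem (Suc n)"] rem_pos[of "Suc n"]
    by (simp only: prod.lessThan_Suc less_imp_le)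
qed

text \<open>The last factor is again a quotient over \<open>rem n\<close>, now with
  \<open>stick u n\<close> on top. The value is the second moment of a Beta distribution with
  parameters \<open>b * stick u n\<close> and \<open>b * (1 - stick u n)\<close>.\<close>

lemma stick_square:
  "(\<integral>\<^sup>+w. ennreal ((stick w n)\<^sup>2) \<partial>PiM UNIV B) = ennreal (stick u n * (b * stick u n + 1) / (b + 1))"
proof -
  have "(\<integral>\<^sup>+x. ennreal (x\<^sup>2) \<partial>B n)
      = ennreal (b * stick u n * (b * stick u n + 1) / (b * rem n * (b * rem n + 1)))"
    unfolding B_eq using beta_params[of n] by (simp only: nn_integral_beta_dist_square)
  then show ?thesis
    using second_moment_ratio[OF rem_pos[of n], of "stick u n"] stick_pos[of n]
    by (simp only: nn_integral_stick_square prod_compl_square less_imp_le)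
qed

text \<open>In the second moment the quadratic part has coefficient b / (b + 1), at most 1; the
  linear part \<open>stick u n / (1 + b)\<close> sums to \<open>1 / (1 + b)\<close> because the
  pieces have total mass 1.\<close>

lemma sum_stick_square:
  assumes "prob_vector (stick u)"
  shows "(\<integral>\<^sup>+w. (\<Sum>n. ennreal ((stick w n)\<^sup>2)) \<partial>PiM UNIV B) \<le> (\<Sum>n. ennreal ((stick u n)\<^sup>2)) + ennreal (1 / (1 + b))"
proof -
  have "(\<integral>\<^sup>+w. (\<Sum>n. ennreal ((stick w n)\<^sup>2)) \<partial>PiM UNIV B)
     = (\<Sum>n. \<integral>\<^sup>+w. ennreal ((stick w n)\<^sup>2) \<partial>PiM UNIV B)"
    by (subst nn_integral_suminf) (auto simp: measurable_cong_sets[OF sets_PiM refl])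
  also have "\<dots> \<le> (\<Sum>n. ennreal ((stick u n)\<^sup>2) + ennreal (stick u n / (1 + b)))"
  proof (intro suminf_le summableI)
    fix n
    have "stick u n * (b * stick u n + 1) / (b + 1) \<le> (stick u n)\<^sup>2 + stick u n / (1 + b)"
      using b by (simp add: divide_simps) (simp add: power2_eq_square algebra_simps)
    moreover have "ennreal ((stick u n)\<^sup>2) + ennreal (stick u n / (1 + b)) = ennreal ((stick u n)\<^sup>2 + stick u n / (1 + b))"
      using stick_pos[of n] b by (intro ennreal_plus[symmetric]) auto
    ultimately show "(\<integral>\<^sup>+w. ennreal ((stick w n)\<^sup>2) \<partial>PiM UNIV B) \<le> ennreal ((stick u n)\<^sup>2) + ennreal (stick u n / (1 + b))"
      unfolding stick_square by (simp only: ennreal_leI)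
  qed
  also have "\<dots> = (\<Sum>n. ennreal ((stick u n)\<^sup>2)) + ennreal (1 / (1 + b))"
  proof -
    have "(\<Sum>n. ennreal (stick u n / (1 + b))) = ennreal (1 / (1 + b))"
      using assms b sums_divide[of "stick u" 1 "1 + b"] stick_pos[THEN less_imp_le]
      by (intro suminf_ennreal_eq) (auto simp: prob_vector_def)
    then show ?thesis by (simp add: suminf_add[symmetric])
  qed
  finally show ?thesis .
qed

end

section \<open>Purely atomic random measures\<close>

lemma space_unit_borel [simp]: "space unit_borel = {0..1}"
  by (simp add: unit_borel_def space_restrict_space)

lemma continuous_on_measurable_unit_borel:
  "continuous_on {0..1} g \<Longrightarrow> g \<in> borel_measurable unit_borel"
  unfolding unit_borel_def by (rule borel_measurable_continuous_on_restrict)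

text \<open>As the image under \<open>x\<close> of a weighted counting measure on the indices, the
  set function is countably additive, and integrals against it become series.\<close>

lemma atomic_eq_distr:
  assumes v: "prob_vector v" and x: "\<And>n. x n \<in> {0..1}"
  shows "atomic v x = distr (density (count_space UNIV) (\<lambda>n. ennreal (v n))) unit_borel x"
    (is "_ = ?D")
proof -
  have m: "x \<in> density (count_space UNIV) (\<lambda>n. ennreal (v n)) \<rightarrow>\<^sub>M unit_borel"
    using x by (auto simp: measurable_def)
  have "?D = measure_of (space ?D) (sets ?D) (emeasure ?D)"
    by (rule measure_of_of_measure[symmetric])
  also have "\<dots> = measure_of (space unit_borel) (sets unit_borel)
      (\<lambda>A. \<Sum>n. ennreal (v n) * emeasure (return unit_borel (x n)) A)"
    unfolding space_distr sets_distr
  proof (rule measure_of_eq[OF sets.space_closed])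
    fix A assume "A \<in> sigma_sets (space unit_borel) (sets unit_borel)"
    then have A: "A \<in> sets unit_borel" by (simp only: sets.sigma_sets_eq)
    show "emeasure ?D A = (\<Sum>n. ennreal (v n) * emeasure (return unit_borel (x n)) A)"
      using A m
      by (simp add: emeasure_distr emeasure_density nn_integral_count_space_nat indicator_vimage)
  qed
  finally show ?thesis
    using v unfolding atomic_def prob_vector_def by simp
qed

lemma emeasure_atomic:
  assumes x: "\<And>n. x n \<in> {0..1}" and A: "A \<in> sets unit_borel"
  shows "emeasure (atomic v x) A =
    (if prob_vector v then \<Sum>n. ennreal (v n) * indicator A (x n) else indicator A 0)"
proof (cases "prob_vector v")
  case True
  have m: "x \<in> density (count_space UNIV) (\<lambda>n. ennreal (v n)) \<rightarrow>\<^sub>M unit_borel"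
    using x by (auto simp: measurable_def)
  show ?thesis
    using True A m atomic_eq_distr[OF True x]
    by (simp add: emeasure_distr emeasure_density nn_integral_count_space_nat)
      (simp add: indicator_def)
next
  case False
  then have "atomic v x = return unit_borel 0"
    unfolding atomic_def prob_vector_def by (simp only: if_False)
  with False A show ?thesis by simp
qed

lemma sets_atomic [simp]: "sets (atomic v x) = sets unit_borel"
  unfolding atomic_def
  by (split if_split) (intro conjI impI sets.sets_measure_of_eq sets_return)

lemma prob_space_atomic:
  assumes x: "\<And>n. x n \<in> {0..1}"
  shows "prob_space (atomic v x)"
proof (rule prob_spaceI)
  have "space (atomic v x) = {0..1}"
    using sets_eq_imp_space_eq[OF sets_atomic[of v x]] by simp
  moreover have "{0..1} \<in> sets unit_borel" using sets.top[of unit_borel] by simp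
  moreover have "(\<Sum>n. ennreal (v n)) = 1" if "prob_vector v"
    using that by (subst suminf_ennreal_eq[of v 1]) (simp_all add: prob_vector_def)
  ultimately show "emeasure (atomic v x) (space (atomic v x)) = 1"
    using x by (simp add: emeasure_atomic)
qed

text \<open>The bound on \<open>g\<close> makes the series absolutely convergent. The conclusion is
  kept as \<open>sums\<close> because the variance estimate works with partial sums.\<close>

lemma integral_atomic:
  assumes v: "prob_vector v" and x: "\<And>n. x n \<in> {0..1}"
    and g: "g \<in> borel_measurable unit_borel" and C: "\<And>y. y \<in> {0..1} \<Longrightarrow> \<bar>g y\<bar> \<le> C"
  shows "(\<lambda>n. v n * g (x n)) sums (\<integral>y. g y \<partial>atomic v x)"
proof -
  have m: "x \<in> density (count_space UNIV) (\<lambda>n. ennreal (v n)) \<rightarrow>\<^sub>M unit_borel"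
    using x by (auto simp: measurable_def)
  have vn: "0 \<le> v n" for n using v by (simp add: prob_vector_def)
  have s: "summable (\<lambda>n. norm (v n * g (x n)))"
  proof (rule summable_comparison_test')
    show "summable (\<lambda>n. C * v n)"
      using v by (intro summable_mult) (auto simp: prob_vector_def sums_iff)
    show "norm (norm (v n * g (x n))) \<le> C * v n" for n
      using C[OF x, of n] vn[of n] by (simp add: abs_mult mult.commute[of C] mult_left_mono)
  qed
  have "(\<integral>y. g y \<partial>atomic v x) = (\<integral>n. g (x n) \<partial>density (count_space UNIV) (\<lambda>n. ennreal (v n)))"
    unfolding atomic_eq_distr[OF v x] by (rule integral_distr[OF m g])
  also have "\<dots> = (\<integral>n. v n * g (x n) \<partial>count_space UNIV)"
    using vn by (subst integral_density) auto
  also have "\<dots> = (\<Sum>n. v n * g (x n))"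
    using s by (intro integral_count_space_nat) (simp add: integrable_count_space_nat_iff)
  finally show ?thesis
    using summable_norm_cancel[OF s] by (simp add: summable_sums)
qed

text \<open>For nonnegative \<open>v\<close>, summing to 1 is expressed in \<open>ennreal\<close>, where it is visibly measurable.\<close>

lemma measurable_prob_vector [measurable]: "Measurable.pred seq_borel prob_vector"
proof -
  have eq: "prob_vector v \<longleftrightarrow> (\<forall>n. 0 \<le> v n) \<and> (\<Sum>n. ennreal (v n)) = 1" for v
  proof safe
    assume *: "\<forall>n. 0 \<le> v n" "(\<Sum>n. ennreal (v n)) = 1"
    then have "summable v" by (intro summable_suminf_not_top) simp_all
    moreover have "(\<Sum>n. v n) = 1"
      using * suminf_ennreal[of v] by (simp add: ennreal_eq_1)
    ultimately show "prob_vector v" using * by (simp add: prob_vector_def sums_iff)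
  qed (auto simp: prob_vector_def dest: suminf_ennreal_eq[rotated])
  show ?thesis unfolding eq by measurable
qed

abbreviation unit_seq :: "(nat \<Rightarrow> real) measure" where
  "unit_seq \<equiv> \<Pi>\<^sub>M n\<in>(UNIV :: nat set). unit_borel"

lemma measurable_atomic:
  "(\<lambda>(v, x). atomic v x) \<in> seq_borel \<Otimes>\<^sub>M unit_seq \<rightarrow>\<^sub>M prob_algebra unit_borel"
  unfolding split_beta
proof (rule measurable_prob_algebraI)
  have x: "snd p n \<in> {0..1}" if "p \<in> space (seq_borel \<Otimes>\<^sub>M unit_seq)" for p n
    using that by (cases p) (simp add: space_pair_measure space_PiM PiE_iff)
  show "prob_space (atomic (fst p) (snd p))" if "p \<in> space (seq_borel \<Otimes>\<^sub>M unit_seq)" for p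
    using x[OF that] by (rule prob_space_atomic)
  show "(\<lambda>p. atomic (fst p) (snd p)) \<in> seq_borel \<Otimes>\<^sub>M unit_seq \<rightarrow>\<^sub>M subprob_algebra unit_borel"
  proof (rule measurable_subprob_algebra)
    show "subprob_space (atomic (fst p) (snd p))" if "p \<in> space (seq_borel \<Otimes>\<^sub>M unit_seq)" for p
      using x[OF that] by (intro prob_space_imp_subprob_space prob_space_atomic)
    show "sets (atomic (fst p) (snd p)) = sets unit_borel" for p
      by (rule sets_atomic)
    fix A assume A [measurable]: "A \<in> sets unit_borel"
    \<comment> \<open>Written out over both branches, the mass of a set is a countable sum of
      coordinate functions under a measurable case distinction, hence jointly measurable in masses
      and points.\<close>
    have "(\<lambda>p. if prob_vector (fst p) then \<Sum>n. ennreal (fst p n) * indicator A (snd p n) else indicator A 0)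
        \<in> borel_measurable (seq_borel \<Otimes>\<^sub>M unit_seq)"
      by measurable
    then show "(\<lambda>p. emeasure (atomic (fst p) (snd p)) A) \<in> borel_measurable (seq_borel \<Otimes>\<^sub>M unit_seq)"
      by (rule measurable_cong[THEN iffD1, rotated]) (rule emeasure_atomic[OF x A, symmetric])
  qed
qed

section \<open>Variance of averages over independent points\<close>

lemma space_prob_algebra_unit_borel:
  assumes "\<mu> \<in> space (prob_algebra unit_borel)"
  shows "prob_space \<mu>" "sets \<mu> = sets unit_borel" "space \<mu> = {0..1}"
  using assms sets_eq_imp_space_eq[of \<mu> unit_borel] by (auto simp: space_prob_algebra)

text \<open>In the expanded square only the diagonal survives, since the \<open>h (x i)\<close> are
  independent and centred; each diagonal term is at most \<open>D\<^sup>2\<close>. Finite sums of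
  bounded functions keep everything integrable.\<close>

lemma nn_integral_sum_square_centred:
  fixes h :: "real \<Rightarrow> real"
  assumes \<mu>: "\<mu> \<in> space (prob_algebra unit_borel)"
    and h [measurable]: "h \<in> borel_measurable unit_borel" and D: "\<And>y. y \<in> {0..1} \<Longrightarrow> \<bar>h y\<bar> \<le> D"
    and mean: "(\<integral>y. h y \<partial>\<mu>) = 0"
  shows "(\<integral>\<^sup>+x. ennreal ((\<Sum>i<n. v i * h (x i))\<^sup>2) \<partial>(\<Pi>\<^sub>M i\<in>(UNIV::nat set). \<mu>)) \<le> ennreal (\<Sum>i<n. D\<^sup>2 * (v i)\<^sup>2)"
proof -
  note prob = space_prob_algebra_unit_borel(1)[OF \<mu>]
  note [simp, measurable_cong] = space_prob_algebra_unit_borel(2)[OF \<mu>]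
  note [simp] = space_prob_algebra_unit_borel(3)[OF \<mu>]
  let ?P = "\<Pi>\<^sub>M i\<in>(UNIV::nat set). \<mu>"
  interpret P: prob_space ?P by (intro prob_space_PiM prob)
  have x: "x i \<in> {0..1}" if "x \<in> space ?P" for x i
    using that by (auto simp: space_PiM PiE_iff)
  have "0 \<le> D" using D[of 0] by force
  have hm [measurable]: "h \<in> borel_measurable \<mu>" by measurable
  have int_h: "integrable ?P (\<lambda>x. h (x i))" for i
    by (rule P.integrable_const_bound[where B=D]) (auto intro!: AE_I2 D x simp del: atLeastAtMost_iff)
  have int_hh: "integrable ?P (\<lambda>x. h (x i) * h (x j))" for i j
    by (rule P.integrable_const_bound[where B="D * D"])
      (auto intro!: AE_I2 mult_mono D x \<open>0 \<le> D\<close> simp: abs_mult simp del: atLeastAtMost_iff)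
  have mean_h: "(\<integral>x. h (x i) \<partial>?P) = 0" for i
  proof -
    have "(\<integral>x. h (x i) \<partial>?P) = (\<integral>y. h y \<partial>distr ?P \<mu> (\<lambda>x. x i))"
      by (subst integral_distr) auto
    also have "\<dots> = 0" by (subst distr_PiM_component) (auto simp: prob mean)
    finally show ?thesis .
  qed
  have var: "(\<integral>x. h (x i) * h (x i) \<partial>?P) \<le> D\<^sup>2" for i
  proof -
    have "(\<integral>x. h (x i) * h (x i) \<partial>?P) \<le> (\<integral>x. D\<^sup>2 \<partial>?P)"
    proof (rule integral_mono[OF int_hh])
      show "h (x i) * h (x i) \<le> D\<^sup>2" if "x \<in> space ?P" for x
        using D[OF x[OF that, of i]] \<open>0 \<le> D\<close>
        by (simp add: power2_eq_square[symmetric] abs_le_square_iff[symmetric])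
    qed simp
    then show ?thesis by (simp add: P.prob_space)
  qed
  have cov: "(\<integral>x. h (x i) * h (x j) \<partial>?P) = 0" if "i \<noteq> j" for i j
  proof -
    have "P.indep_vars (\<lambda>_. \<mu>) (\<lambda>i x. x i) UNIV"
      by (rule indep_vars_PiM_coordinates[OF prob])
    then have "P.indep_vars (\<lambda>_. borel) (\<lambda>i x. h (x i)) UNIV"
      by (rule P.indep_vars_compose2) simp
    then have "P.indep_vars (\<lambda>_. borel) (\<lambda>i x. h (x i)) {i, j}"
      by (rule P.indep_vars_subset) auto
    from P.indep_vars_lebesgue_integral[OF _ this int_h] that
    show ?thesis by (simp add: mean_h)
  qed
  have sq: "(\<Sum>i<n. v i * h (x i))\<^sup>2 = (\<Sum>i<n. \<Sum>j<n. v i * v j * (h (x i) * h (x j)))" for x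
    by (simp add: power2_eq_square sum_product mult_ac)
  have int_S: "integrable ?P (\<lambda>x. (\<Sum>i<n. v i * h (x i))\<^sup>2)"
    unfolding sq by (intro Bochner_Integration.integrable_sum integrable_mult_right int_hh)
  have "(\<integral>x. (\<Sum>i<n. v i * h (x i))\<^sup>2 \<partial>?P) = (\<Sum>i<n. \<Sum>j<n. v i * v j * (\<integral>x. h (x i) * h (x j) \<partial>?P))"
    unfolding sq
    by (simp add: Bochner_Integration.integral_sum Bochner_Integration.integrable_sum integrable_mult_right int_hh del: integral_mult_right_zero)
  also have "\<dots> = (\<Sum>i<n. (v i)\<^sup>2 * (\<integral>x. h (x i) * h (x i) \<partial>?P))"
  proof (intro sum.cong refl)
    fix i assume "i \<in> {..<n}"
    moreover have "(\<Sum>j<n. v i * v j * (\<integral>x. h (x i) * h (x j) \<partial>?P))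
      = (\<Sum>j<n. if j = i then (v i)\<^sup>2 * (\<integral>x. h (x i) * h (x i) \<partial>?P) else 0)"
      using cov by (intro sum.cong refl) (auto simp: power2_eq_square)
    ultimately show "(\<Sum>j<n. v i * v j * (\<integral>x. h (x i) * h (x j) \<partial>?P)) = (v i)\<^sup>2 * (\<integral>x. h (x i) * h (x i) \<partial>?P)"
      by simp
  qed
  also have "\<dots> \<le> (\<Sum>i<n. D\<^sup>2 * (v i)\<^sup>2)"
    using var by (intro sum_mono) (simp add: mult.commute[of "D\<^sup>2"] mult_left_mono)
  finally show ?thesis
    using nn_integral_eq_integral[OF int_S] by (simp add: ennreal_leI)
qed

text \<open>Fatou's lemma carries the estimate from finite sums to the series. Centring
  \<open>g\<close> at its mean can double its bound C, whence the factor 4.\<close>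

lemma atomic_second_moment:
  assumes \<mu>: "\<mu> \<in> space (prob_algebra unit_borel)" and v: "prob_vector v"
    and g [measurable]: "g \<in> borel_measurable unit_borel" and C: "\<And>y. y \<in> {0..1} \<Longrightarrow> \<bar>g y\<bar> \<le> C"
  shows "(\<integral>\<^sup>+x. ennreal (((\<integral>y. g y \<partial>atomic v x) - (\<integral>y. g y \<partial>\<mu>))\<^sup>2) \<partial>(\<Pi>\<^sub>M i\<in>(UNIV::nat set). \<mu>))
    \<le> ennreal (4 * C\<^sup>2) * (\<Sum>n. ennreal ((v n)\<^sup>2))"
proof -
  note prob = space_prob_algebra_unit_borel(1)[OF \<mu>]
  note [simp, measurable_cong] = space_prob_algebra_unit_borel(2)[OF \<mu>]
  note sp = space_prob_algebra_unit_borel(3)[OF \<mu>]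
  interpret \<mu>: prob_space \<mu> by fact
  let ?P = "\<Pi>\<^sub>M i\<in>(UNIV::nat set). \<mu>"
  define m where "m = (\<integral>y. g y \<partial>\<mu>)"
  define h where "h y = g y - m" for y
  have h [measurable]: "h \<in> borel_measurable unit_borel" unfolding h_def by measurable
  have int_g: "integrable \<mu> g"
    by (rule \<mu>.integrable_const_bound[where B=C]) (use C sp in auto)
  have "\<bar>m\<bar> \<le> (\<integral>y. \<bar>g y\<bar> \<partial>\<mu>)" unfolding m_def by simp
  also have "\<dots> \<le> (\<integral>y. C \<partial>\<mu>)" using int_g C sp by (intro integral_mono) auto
  finally have m: "\<bar>m\<bar> \<le> C" by (simp add: \<mu>.prob_space)
  have D: "\<bar>h y\<bar> \<le> 2 * C" if "y \<in> {0..1}" for y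
    using C[OF that] m by (simp add: h_def)
  have mean: "(\<integral>y. h y \<partial>\<mu>) = 0"
    using int_g by (simp add: h_def m_def \<mu>.prob_space)
  have x: "x i \<in> {0..1}" if "x \<in> space ?P" for x i
    using that sp by (auto simp: space_PiM PiE_iff)
  have "(\<integral>\<^sup>+x. ennreal (((\<integral>y. g y \<partial>atomic v x) - m)\<^sup>2) \<partial>?P)
    = (\<integral>\<^sup>+x. liminf (\<lambda>n. ennreal ((\<Sum>i<n. v i * h (x i))\<^sup>2)) \<partial>?P)"
  proof (rule nn_integral_cong)
    fix x assume "x \<in> space ?P"
    then have "(\<lambda>n. v n * g (x n)) sums (\<integral>y. g y \<partial>atomic v x)"
      using x by (intro integral_atomic[OF v _ g C]) auto
    \<comment> \<open>Since the masses sum to 1, the mean can be distributed over the terms, and the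
      deviation becomes a series in the centred function \<open>h\<close>.\<close>
    moreover have "(\<lambda>n. v n * m) sums (1 * m)"
      using v by (intro sums_mult2) (auto simp: prob_vector_def)
    ultimately have "(\<lambda>n. v n * h (x n)) sums ((\<integral>y. g y \<partial>atomic v x) - m)"
      using sums_diff by (fastforce simp: h_def right_diff_distrib)
    then have "(\<lambda>n. ennreal ((\<Sum>i<n. v i * h (x i))\<^sup>2)) \<longlonglongrightarrow> ennreal (((\<integral>y. g y \<partial>atomic v x) - m)\<^sup>2)"
      unfolding sums_def by (intro tendsto_ennrealI tendsto_power)
    then show "ennreal (((\<integral>y. g y \<partial>atomic v x) - m)\<^sup>2) = liminf (\<lambda>n. ennreal ((\<Sum>i<n. v i * h (x i))\<^sup>2))"
      by (intro lim_imp_Liminf[symmetric]) auto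
  qed
  also have "\<dots> \<le> liminf (\<lambda>n. \<integral>\<^sup>+x. ennreal ((\<Sum>i<n. v i * h (x i))\<^sup>2) \<partial>?P)"
    by (intro nn_integral_liminf) measurable
  also have "\<dots> \<le> liminf (\<lambda>n. ennreal (\<Sum>i<n. (2 * C)\<^sup>2 * (v i)\<^sup>2))"
    using D by (intro Liminf_mono always_eventually allI nn_integral_sum_square_centred[OF \<mu> h _ mean])
  also have "\<dots> \<le> (\<Sum>n. ennreal ((2 * C)\<^sup>2 * (v n)\<^sup>2))"
  proof (rule Liminf_le)
    show "\<forall>\<^sub>F n in sequentially. ennreal (\<Sum>i<n. (2 * C)\<^sup>2 * (v i)\<^sup>2) \<le> (\<Sum>n. ennreal ((2 * C)\<^sup>2 * (v n)\<^sup>2))"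
      by (intro always_eventually allI) (simp add: sum_ennreal[symmetric] sum_le_suminf del: sum_ennreal)
  qed simp
  also have "\<dots> = ennreal (4 * C\<^sup>2) * (\<Sum>n. ennreal ((v n)\<^sup>2))"
    by (simp add: power_mult_distrib ennreal_mult)
  finally show ?thesis unfolding m_def .
qed

lemma measurable_atomic_stick:
  "(\<lambda>(w, x). atomic (stick w) x) \<in> seq_borel \<Otimes>\<^sub>M unit_seq \<rightarrow>\<^sub>M prob_algebra unit_borel"
proof -
  have "(\<lambda>(w, x). (stick w, x)) \<in> seq_borel \<Otimes>\<^sub>M unit_seq \<rightarrow>\<^sub>M seq_borel \<Otimes>\<^sub>M unit_seq"
    by measurable
  from measurable_compose[OF this measurable_atomic] show ?thesis
    by (simp add: split_beta)
qed

lemma measurable_integral_prob_algebra: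
  fixes g :: "real \<Rightarrow> real"
  assumes "g \<in> borel_measurable T"
  shows "(\<lambda>N. \<integral>y. g y \<partial>N) \<in> borel_measurable (prob_algebra T)"
  using integral_measurable_subprob_algebra[OF assms]
  unfolding prob_algebra_def by (rule measurable_restrict_space1)

text \<open>On a product space the points are integrated first, with the fractions fixed; for almost
  every \<open>w\<close> the estimate for deterministic masses applies.\<close>

lemma random_atomic_second_moment:
  assumes \<mu>: "\<mu> \<in> space (prob_algebra unit_borel)"
    and g: "g \<in> borel_measurable unit_borel" and C: "\<And>y. y \<in> {0..1} \<Longrightarrow> \<bar>g y\<bar> \<le> C"
    and N: "prob_space N" "sets N = sets seq_borel" "AE w in N. prob_vector (stick w)"
  shows "(\<integral>\<^sup>+(w, x). ennreal (((\<integral>y. g y \<partial>atomic (stick w) x) - (\<integral>y. g y \<partial>\<mu>))\<^sup>2) \<partial>(N \<Otimes>\<^sub>M (\<Pi>\<^sub>M i\<in>(UNIV::nat set). \<mu>)))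
    \<le> ennreal (4 * C\<^sup>2) * (\<integral>\<^sup>+w. (\<Sum>n. ennreal ((stick w n)\<^sup>2)) \<partial>N)"
proof -
  note prob = space_prob_algebra_unit_borel(1)[OF \<mu>]
  have sets_P: "sets (\<Pi>\<^sub>M i\<in>(UNIV::nat set). \<mu>) = sets unit_seq"
    using space_prob_algebra_unit_borel(2)[OF \<mu>] by (intro sets_PiM_cong) auto
  interpret P: prob_space "\<Pi>\<^sub>M i\<in>(UNIV::nat set). \<mu>" by (intro prob_space_PiM prob)
  have sets_pair: "sets (N \<Otimes>\<^sub>M (\<Pi>\<^sub>M i\<in>(UNIV::nat set). \<mu>)) = sets (seq_borel \<Otimes>\<^sub>M unit_seq)"
    by (intro sets_pair_measure_cong N(2) sets_P)
  have "(\<lambda>p. \<integral>y. g y \<partial>(case p of (w, x) \<Rightarrow> atomic (stick w) x)) \<in> borel_measurable (seq_borel \<Otimes>\<^sub>M unit_seq)"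
    by (rule measurable_compose[OF measurable_atomic_stick measurable_integral_prob_algebra[OF g]])
  then have m: "(\<lambda>(w, x). ennreal (((\<integral>y. g y \<partial>atomic (stick w) x) - (\<integral>y. g y \<partial>\<mu>))\<^sup>2))
      \<in> borel_measurable (N \<Otimes>\<^sub>M (\<Pi>\<^sub>M i\<in>(UNIV::nat set). \<mu>))"
    unfolding measurable_cong_sets[OF sets_pair refl] split_beta by measurable
  have "(\<integral>\<^sup>+(w, x). ennreal (((\<integral>y. g y \<partial>atomic (stick w) x) - (\<integral>y. g y \<partial>\<mu>))\<^sup>2) \<partial>(N \<Otimes>\<^sub>M (\<Pi>\<^sub>M i\<in>(UNIV::nat set). \<mu>)))
    = (\<integral>\<^sup>+w. (\<integral>\<^sup>+x. ennreal (((\<integral>y. g y \<partial>atomic (stick w) x) - (\<integral>y. g y \<partial>\<mu>))\<^sup>2) \<partial>(\<Pi>\<^sub>M i\<in>(UNIV::nat set). \<mu>)) \<partial>N)"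
    using P.nn_integral_fst[OF m] by simp
  also have "\<dots> \<le> (\<integral>\<^sup>+w. ennreal (4 * C\<^sup>2) * (\<Sum>n. ennreal ((stick w n)\<^sup>2)) \<partial>N)"
    using N(3) by (intro nn_integral_mono_AE) (auto elim!: eventually_mono intro!: atomic_second_moment \<mu> g C)
  also have "\<dots> = ennreal (4 * C\<^sup>2) * (\<integral>\<^sup>+w. (\<Sum>n. ennreal ((stick w n)\<^sup>2)) \<partial>N)"
    by (intro nn_integral_cmult) (simp add: measurable_cong_sets[OF N(2) refl])
  finally show ?thesis .
qed

lemma AE_prob_vector_iid:
  assumes "0 < a"
  shows "AE w in PiM UNIV (\<lambda>_::nat. beta_dist 1 a). prob_vector (stick w)"
proof -
  interpret unit_factors "\<lambda>_. beta_dist 1 a" using assms by (intro unit_factors_beta_dist) auto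
  show ?thesis
    using AE_unit by (intro AE_prob_vector_stick sets_PiM)
      (auto simp: remainder_sum_iid assms elim!: eventually_mono less_imp_le)
qed

lemma dirichlet_process_law_prob:
  assumes \<mu>: "\<mu> \<in> space (prob_algebra unit_borel)" and "0 < a"
  shows "(\<lambda>(w, x). atomic (stick w) x) \<in> (\<Pi>\<^sub>M n\<in>(UNIV :: nat set). beta_dist 1 a) \<Otimes>\<^sub>M (\<Pi>\<^sub>M n\<in>(UNIV :: nat set). \<mu>)
      \<rightarrow>\<^sub>M prob_algebra unit_borel"
    and "prob_space (dirichlet_process_law a \<mu>)"
    and "sets (dirichlet_process_law a \<mu>) = sets (prob_algebra unit_borel)"
proof -
  interpret unit_factors "\<lambda>_. beta_dist 1 a" using assms by (intro unit_factors_beta_dist) auto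
  have "sets (\<Pi>\<^sub>M i\<in>(UNIV::nat set). \<mu>) = sets unit_seq"
    using space_prob_algebra_unit_borel(2)[OF \<mu>] by (intro sets_PiM_cong) auto
  then show m: "(\<lambda>(w, x). atomic (stick w) x) \<in> (\<Pi>\<^sub>M n\<in>(UNIV :: nat set). beta_dist 1 a) \<Otimes>\<^sub>M (\<Pi>\<^sub>M n\<in>(UNIV :: nat set). \<mu>)
      \<rightarrow>\<^sub>M prob_algebra unit_borel"
    using measurable_atomic_stick measurable_cong_sets[OF sets_pair_measure_cong[OF sets_PiM] refl] by blast
  have "prob_space (\<Pi>\<^sub>M i\<in>(UNIV::nat set). \<mu>)"
    by (intro prob_space_PiM space_prob_algebra_unit_borel \<mu>)
  then have "prob_space ((\<Pi>\<^sub>M n\<in>(UNIV :: nat set). beta_dist 1 a) \<Otimes>\<^sub>M (\<Pi>\<^sub>M n\<in>(UNIV :: nat set). \<mu>))"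
    by (intro prob_space_pair P.prob_space_axioms)
  then show "prob_space (dirichlet_process_law a \<mu>)"
    unfolding dirichlet_process_law_def using m by (rule prob_space.prob_space_distr)
  show "sets (dirichlet_process_law a \<mu>) = sets (prob_algebra unit_borel)"
    by (simp add: dirichlet_process_law_def)
qed

lemma dirichlet_process_second_moment:
  assumes \<mu>: "\<mu> \<in> space (prob_algebra unit_borel)" and "0 < a"
    and g: "g \<in> borel_measurable unit_borel" and C: "\<And>y. y \<in> {0..1} \<Longrightarrow> \<bar>g y\<bar> \<le> C"
  shows "(\<integral>\<^sup>+N. ennreal (((\<integral>y. g y \<partial>N) - (\<integral>y. g y \<partial>\<mu>))\<^sup>2) \<partial>dirichlet_process_law a \<mu>) \<le> ennreal (4 * C\<^sup>2 / (1 + a))"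
proof -
  interpret unit_factors "\<lambda>_. beta_dist 1 a" using assms by (intro unit_factors_beta_dist) auto
  have m: "(\<lambda>N. ennreal (((\<integral>y. g y \<partial>N) - (\<integral>y. g y \<partial>\<mu>))\<^sup>2)) \<in> borel_measurable (prob_algebra unit_borel)"
    using measurable_integral_prob_algebra[OF g] by measurable
  have "(\<integral>\<^sup>+N. ennreal (((\<integral>y. g y \<partial>N) - (\<integral>y. g y \<partial>\<mu>))\<^sup>2) \<partial>dirichlet_process_law a \<mu>)
     = (\<integral>\<^sup>+(w, x). ennreal (((\<integral>y. g y \<partial>atomic (stick w) x) - (\<integral>y. g y \<partial>\<mu>))\<^sup>2)
        \<partial>((\<Pi>\<^sub>M n\<in>(UNIV :: nat set). beta_dist 1 a) \<Otimes>\<^sub>M (\<Pi>\<^sub>M n\<in>(UNIV :: nat set). \<mu>)))"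
    unfolding dirichlet_process_law_def
    using m by (subst nn_integral_distr[OF dirichlet_process_law_prob(1)[OF \<mu> \<open>0 < a\<close>]]) (simp_all add: case_prod_unfold)
  also have "\<dots> \<le> ennreal (4 * C\<^sup>2) * ennreal (1 / (1 + a))"
    using random_atomic_second_moment[OF \<mu> g C P.prob_space_axioms sets_PiM AE_prob_vector_iid[OF \<open>0 < a\<close>]]
    by (simp only: stick_square_iid[OF \<open>0 < a\<close>])
  also have "\<dots> = ennreal (4 * C\<^sup>2 / (1 + a))"
    using \<open>0 < a\<close> by (simp add: ennreal_mult[symmetric])
  finally show ?thesis .
qed

section \<open>Conditional laws\<close>

text \<open>\<open>has_cond_law\<close> prescribes conditional probabilities one set at a time, each
  outside its own null set. The induction over nonnegative measurable functions turns this into a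
  formula for expectations.\<close>

lemma nn_integral_cond_law:
  assumes "prob_space M" and cond: "has_cond_law M T X S Y K"
    and K: "AE \<omega> in M. prob_space (K (Y \<omega>)) \<and> sets (K (Y \<omega>)) = sets T"
    and h: "h \<in> borel_measurable T"
  shows "(\<integral>\<^sup>+\<omega>. h (X \<omega>) \<partial>M) = (\<integral>\<^sup>+\<omega>. (\<integral>\<^sup>+x. h x \<partial>K (Y \<omega>)) \<partial>M)"
proof -
  interpret M: prob_space M by fact
  have X [measurable]: "X \<in> M \<rightarrow>\<^sub>M T" and Y: "Y \<in> M \<rightarrow>\<^sub>M S"
    using cond by (auto simp: has_cond_law_def)
  define F where "F = vimage_algebra (space M) Y S"
  have "Y \<in> space M \<rightarrow> space S" using Y by (simp add: measurable_def)
  then have "subalgebra M F"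
    using measurable_sets[OF Y] by (auto simp: subalgebra_def F_def sets_vimage_algebra2)
  then interpret F: finite_measure_subalgebra M F
    by unfold_locales
  \<comment> \<open>The kernel \<open>K\<close> is not assumed measurable, so the induction carries along a measurable version \<open>G\<close>
    of the inner integral.\<close>
  have "\<exists>G\<in>borel_measurable M. (AE \<omega> in M. G \<omega> = (\<integral>\<^sup>+x. h x \<partial>K (Y \<omega>))) \<and>
      (\<integral>\<^sup>+\<omega>. G \<omega> \<partial>M) = (\<integral>\<^sup>+\<omega>. h (X \<omega>) \<partial>M)"
    using h
  proof induction
    case (cong f g)
    have "AE \<omega> in M. (\<integral>\<^sup>+x. f x \<partial>K (Y \<omega>)) = (\<integral>\<^sup>+x. g x \<partial>K (Y \<omega>))"
      using K by eventually_elim (auto intro!: nn_integral_cong cong dest: sets_eq_imp_space_eq)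
    moreover have "(\<integral>\<^sup>+\<omega>. f (X \<omega>) \<partial>M) = (\<integral>\<^sup>+\<omega>. g (X \<omega>) \<partial>M)"
      by (intro nn_integral_cong cong measurable_space[OF X])
    ultimately show ?case using cong(4) by (auto elim!: bexI[rotated] eventually_elim2)
  next
    case (set A)
    let ?I = "indicator (X -` A \<inter> space M) :: _ \<Rightarrow> real"
    let ?c = "real_cond_exp M F ?I"
    have A: "X -` A \<inter> space M \<in> sets M" using X set by (rule measurable_sets)
    have c: "AE \<omega> in M. ?c \<omega> = measure (K (Y \<omega>)) A"
      using cond set by (auto simp: has_cond_law_def F_def)
    have int: "integrable M ?I" using A by (simp add: M.emeasure_eq_measure)
    \<comment> \<open>Being almost surely equal to a probability, \<open>?c\<close> is nonnegative,
      so its integral can be moved to \<open>ennreal\<close>; there it equals that of the indicator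
      by the defining property of conditional expectation.\<close>
    have "(\<integral>\<^sup>+\<omega>. ennreal (?c \<omega>) \<partial>M) = ennreal (\<integral>\<omega>. ?c \<omega> \<partial>M)"
      using c by (intro nn_integral_eq_integral F.real_cond_exp_int(1) int) (auto elim!: eventually_mono)
    also have "\<dots> = ennreal (\<integral>\<omega>. ?I \<omega> \<partial>M)" by (simp add: F.real_cond_exp_int(2)[OF int])
    also have "\<dots> = (\<integral>\<^sup>+\<omega>. indicator A (X \<omega>) \<partial>M)"
      using A by (simp add: M.emeasure_eq_measure[symmetric] flip: nn_integral_indicator)
        (auto intro!: nn_integral_cong simp: indicator_def)
    finally have "(\<integral>\<^sup>+\<omega>. ennreal (?c \<omega>) \<partial>M) = (\<integral>\<^sup>+\<omega>. indicator A (X \<omega>) \<partial>M)" .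
    moreover have "AE \<omega> in M. ennreal (?c \<omega>) = (\<integral>\<^sup>+x. indicator A x \<partial>K (Y \<omega>))"
      using c K
    proof eventually_elim
      case (elim \<omega>)
      then interpret k: prob_space "K (Y \<omega>)" by simp
      show ?case using elim set by (simp add: k.emeasure_eq_measure)
    qed
    ultimately show ?case by (intro bexI[of _ "\<lambda>\<omega>. ennreal (?c \<omega>)"]) auto
  next
    case (mult u c)
    then obtain G where [measurable]: "G \<in> borel_measurable M"
      and G: "AE \<omega> in M. G \<omega> = (\<integral>\<^sup>+x. u x \<partial>K (Y \<omega>))" "(\<integral>\<^sup>+\<omega>. G \<omega> \<partial>M) = (\<integral>\<^sup>+\<omega>. u (X \<omega>) \<partial>M)"
      by blast
    have [measurable]: "u \<in> borel_measurable T" by fact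
    have "AE \<omega> in M. c * G \<omega> = (\<integral>\<^sup>+x. c * u x \<partial>K (Y \<omega>))"
      using K G(1)
    proof eventually_elim
      case (elim \<omega>)
      then have "u \<in> borel_measurable (K (Y \<omega>))" using mult measurable_cong_sets by blast
      then show ?case using elim by (simp add: nn_integral_cmult)
    qed
    then show ?case using G(2) by (intro bexI[of _ "\<lambda>\<omega>. c * G \<omega>"]) (auto simp: nn_integral_cmult)
  next
    case (add u v)
    then obtain G H where [measurable]: "G \<in> borel_measurable M" "H \<in> borel_measurable M"
      and G: "AE \<omega> in M. G \<omega> = (\<integral>\<^sup>+x. u x \<partial>K (Y \<omega>))" "(\<integral>\<^sup>+\<omega>. G \<omega> \<partial>M) = (\<integral>\<^sup>+\<omega>. u (X \<omega>) \<partial>M)"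
      and H: "AE \<omega> in M. H \<omega> = (\<integral>\<^sup>+x. v x \<partial>K (Y \<omega>))" "(\<integral>\<^sup>+\<omega>. H \<omega> \<partial>M) = (\<integral>\<^sup>+\<omega>. v (X \<omega>) \<partial>M)"
      by blast
    have [measurable]: "u \<in> borel_measurable T" "v \<in> borel_measurable T" by fact+
    have "AE \<omega> in M. H \<omega> + G \<omega> = (\<integral>\<^sup>+x. v x + u x \<partial>K (Y \<omega>))"
      using K G(1) H(1)
    proof eventually_elim
      case (elim \<omega>)
      then have "u \<in> borel_measurable (K (Y \<omega>))" "v \<in> borel_measurable (K (Y \<omega>))"
        using add measurable_cong_sets by blast+
      then show ?case using elim by (simp add: nn_integral_add)
    qed
    then show ?case using G(2) H(2)
      by (intro bexI[of _ "\<lambda>\<omega>. H \<omega> + G \<omega>"]) (auto simp: nn_integral_add)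
  next
    case (seq U)
    then have "\<forall>i. \<exists>G. G\<in>borel_measurable M \<and> (AE \<omega> in M. G \<omega> = (\<integral>\<^sup>+x. U i x \<partial>K (Y \<omega>))) \<and>
      (\<integral>\<^sup>+\<omega>. G \<omega> \<partial>M) = (\<integral>\<^sup>+\<omega>. U i (X \<omega>) \<partial>M)" by blast
    then obtain G where [measurable]: "\<And>i. G i \<in> borel_measurable M"
      and G: "\<And>i. AE \<omega> in M. G i \<omega> = (\<integral>\<^sup>+x. U i x \<partial>K (Y \<omega>))"
        "\<And>i. (\<integral>\<^sup>+\<omega>. G i \<omega> \<partial>M) = (\<integral>\<^sup>+\<omega>. U i (X \<omega>) \<partial>M)"
      by metis
    have [measurable]: "U i \<in> borel_measurable T" for i by fact
    \<comment> \<open>Countably many exceptional sets merge into one null set, outside of which the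
      monotone limit is taken pointwise.\<close>
    have G': "AE \<omega> in M. \<forall>i. G i \<omega> = (\<integral>\<^sup>+x. U i x \<partial>K (Y \<omega>))"
      using G(1) by (simp add: AE_all_countable)
    have "AE \<omega> in M. (SUP i. G i \<omega>) = (\<integral>\<^sup>+x. (SUP i. U i) x \<partial>K (Y \<omega>))"
      using K G'
    proof eventually_elim
      case (elim \<omega>)
      then have "U i \<in> borel_measurable (K (Y \<omega>))" for i
        using seq(1) measurable_cong_sets by blast
      then show ?case
        using elim \<open>incseq U\<close> by (simp add: image_comp nn_integral_monotone_convergence_SUP)
    qed
    moreover have "(\<integral>\<^sup>+\<omega>. (SUP i. G i \<omega>) \<partial>M) = (SUP i. \<integral>\<^sup>+\<omega>. G i \<omega> \<partial>M)"
    proof (rule nn_integral_monotone_convergence_SUP_AE)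
      show "AE \<omega> in M. G i \<omega> \<le> G (Suc i) \<omega>" for i
        using G' by eventually_elim
          (use \<open>incseq U\<close> in \<open>auto intro!: nn_integral_mono simp: incseq_Suc_iff le_fun_def\<close>)
    qed simp
    moreover have "(\<integral>\<^sup>+\<omega>. (SUP i. U i) (X \<omega>) \<partial>M) = (SUP i. \<integral>\<^sup>+\<omega>. U i (X \<omega>) \<partial>M)"
      using \<open>incseq U\<close> by (simp add: image_comp)
        (intro nn_integral_monotone_convergence_SUP, auto simp: incseq_def le_fun_def)
    ultimately show ?case
      using G(2) by (intro bexI[of _ "\<lambda>\<omega>. SUP i. G i \<omega>"]) auto
  qed
  then obtain G where "AE \<omega> in M. G \<omega> = (\<integral>\<^sup>+x. h x \<partial>K (Y \<omega>))" "(\<integral>\<^sup>+\<omega>. G \<omega> \<partial>M) = (\<integral>\<^sup>+\<omega>. h (X \<omega>) \<partial>M)"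
    by blast
  then show ?thesis using nn_integral_cong_AE by metis
qed

text \<open>By independence the joint law of fractions and points is a product measure, which brings
  the estimate back to random variables on \<open>M\<close>.\<close>

lemma (in prob_space) independent_atomic_second_moment:
  assumes \<mu>: "\<mu> \<in> space (prob_algebra unit_borel)"
    and g: "g \<in> borel_measurable unit_borel" and C: "\<And>y. y \<in> {0..1} \<Longrightarrow> \<bar>g y\<bar> \<le> C"
    and indep: "indep_var seq_borel w unit_seq x"
    and x: "distr M unit_seq x = (\<Pi>\<^sub>M i\<in>(UNIV::nat set). \<mu>)"
    and w: "AE \<omega> in M. prob_vector (stick (w \<omega>))"
  shows "(\<integral>\<^sup>+\<omega>. ennreal (((\<integral>y. g y \<partial>atomic (stick (w \<omega>)) (x \<omega>)) - (\<integral>y. g y \<partial>\<mu>))\<^sup>2) \<partial>M)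
    \<le> ennreal (4 * C\<^sup>2) * (\<integral>\<^sup>+\<omega>. (\<Sum>n. ennreal ((stick (w \<omega>) n)\<^sup>2)) \<partial>M)"
proof -
  have [measurable]: "w \<in> M \<rightarrow>\<^sub>M seq_borel" "x \<in> M \<rightarrow>\<^sub>M unit_seq"
    and pair: "distr M seq_borel w \<Otimes>\<^sub>M distr M unit_seq x = distr M (seq_borel \<Otimes>\<^sub>M unit_seq) (\<lambda>\<omega>. (w \<omega>, x \<omega>))"
    using indep unfolding indep_var_distribution_eq by auto
  have "(\<lambda>p. \<integral>y. g y \<partial>(case p of (w, x) \<Rightarrow> atomic (stick w) x)) \<in> borel_measurable (seq_borel \<Otimes>\<^sub>M unit_seq)"
    by (rule measurable_compose[OF measurable_atomic_stick measurable_integral_prob_algebra[OF g]])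
  then have m: "(\<lambda>(w, x). ennreal (((\<integral>y. g y \<partial>atomic (stick w) x) - (\<integral>y. g y \<partial>\<mu>))\<^sup>2))
      \<in> borel_measurable (seq_borel \<Otimes>\<^sub>M unit_seq)"
    unfolding split_beta by measurable
  have "(\<integral>\<^sup>+\<omega>. ennreal (((\<integral>y. g y \<partial>atomic (stick (w \<omega>)) (x \<omega>)) - (\<integral>y. g y \<partial>\<mu>))\<^sup>2) \<partial>M)
      = (\<integral>\<^sup>+(w, x). ennreal (((\<integral>y. g y \<partial>atomic (stick w) x) - (\<integral>y. g y \<partial>\<mu>))\<^sup>2)
          \<partial>(distr M seq_borel w \<Otimes>\<^sub>M (\<Pi>\<^sub>M i\<in>(UNIV::nat set). \<mu>)))"
    unfolding x[symmetric] pair using m by (subst nn_integral_distr) auto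
  also have "\<dots> \<le> ennreal (4 * C\<^sup>2) * (\<integral>\<^sup>+w. (\<Sum>n. ennreal ((stick w n)\<^sup>2)) \<partial>distr M seq_borel w)"
    using w by (intro random_atomic_second_moment \<mu> g C prob_space_distr) (auto simp: AE_distr_iff)
  also have "(\<integral>\<^sup>+w. (\<Sum>n. ennreal ((stick w n)\<^sup>2)) \<partial>distr M seq_borel w)
      = (\<integral>\<^sup>+\<omega>. (\<Sum>n. ennreal ((stick (w \<omega>) n)\<^sup>2)) \<partial>M)"
    by (subst nn_integral_distr) auto
  finally show ?thesis .
qed

section \<open>Second moments for the hierarchical Dirichlet process\<close>

context hierarchical_dirichlet
begin

lemma measurable_U [measurable]: "(\<lambda>\<omega> n. U n \<omega>) \<in> M \<rightarrow>\<^sub>M seq_borel"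
  using U_indep by (intro measurable_PiM_single') (auto simp: indep_vars_def)

lemma measurable_W [measurable]: "(\<lambda>\<omega> n. W n \<omega>) \<in> M \<rightarrow>\<^sub>M seq_borel"
  using W_cond_law by (simp add: has_cond_law_def)

lemma measurable_xi [measurable]: "(\<lambda>\<omega> n. \<xi> n \<omega>) \<in> M \<rightarrow>\<^sub>M unit_seq"
  using xi_indep by (intro measurable_PiM_single') (auto simp: indep_vars_def measurable_def)

lemma distr_U: "distr M seq_borel (\<lambda>\<omega> n. U n \<omega>) = (\<Pi>\<^sub>M n\<in>(UNIV::nat set). beta_dist 1 \<alpha>)"
proof -
  have rv: "random_variable borel (U n)" for n using U_indep by (simp add: indep_vars_def)
  show ?thesis
    using U_indep unfolding indep_vars_iff_distr_eq_PiM[OF UNIV_not_empty rv] by (simp only: restrict_UNIV U_law)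
qed

lemma distr_xi: "distr M unit_seq (\<lambda>\<omega> n. \<xi> n \<omega>) = (\<Pi>\<^sub>M n\<in>(UNIV::nat set). \<nu>\<^sub>0)"
proof -
  have rv: "random_variable unit_borel (\<xi> n)" for n using xi_indep by (simp add: indep_vars_def)
  show ?thesis
    using xi_indep unfolding indep_vars_iff_distr_eq_PiM[OF UNIV_not_empty rv] by (simp only: restrict_UNIV xi_law)
qed

text \<open>Events determined by a function of the pair (U, W) are already determined by the pair,
  so independence is inherited. The two projections are the cases needed.\<close>

lemma indep_var_xi:
  assumes \<phi>: "\<phi> \<in> seq_borel \<Otimes>\<^sub>M seq_borel \<rightarrow>\<^sub>M seq_borel"
  shows "indep_var seq_borel (\<lambda>\<omega>. \<phi> (\<lambda>n. U n \<omega>, \<lambda>n. W n \<omega>)) unit_seq (\<lambda>\<omega> n. \<xi> n \<omega>)"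
proof -
  let ?P = "\<lambda>\<omega>. (\<lambda>n. U n \<omega>, \<lambda>n. W n \<omega>)"
  have P: "?P \<in> M \<rightarrow>\<^sub>M seq_borel \<Otimes>\<^sub>M seq_borel" by measurable
  have m: "(\<lambda>\<omega>. \<phi> (?P \<omega>)) \<in> M \<rightarrow>\<^sub>M seq_borel" by (rule measurable_compose[OF P \<phi>])
  have "indep_set (sets (vimage_algebra (space M) (\<lambda>\<omega>. \<phi> (?P \<omega>)) seq_borel))
     (sets (vimage_algebra (space M) (\<lambda>\<omega> n. \<xi> n \<omega>) unit_seq))"
  proof (rule indep_setI)
    have sub: "sets (vimage_algebra (space M) (\<lambda>\<omega>. \<phi> (?P \<omega>)) seq_borel)
       \<subseteq> sets (vimage_algebra (space M) ?P (seq_borel \<Otimes>\<^sub>M seq_borel))"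
    proof
      fix a assume "a \<in> sets (vimage_algebra (space M) (\<lambda>\<omega>. \<phi> (?P \<omega>)) seq_borel)"
      then obtain A where A: "A \<in> sets seq_borel" and a: "a = (\<lambda>\<omega>. \<phi> (?P \<omega>)) -` A \<inter> space M"
        using sets_vimage_algebra2[of "\<lambda>\<omega>. \<phi> (?P \<omega>)" "space M" seq_borel] m by (auto simp: measurable_def)
      have "a = ?P -` (\<phi> -` A \<inter> space (seq_borel \<Otimes>\<^sub>M seq_borel)) \<inter> space M"
        using measurable_space[OF P] by (auto simp: a)
      then show "a \<in> sets (vimage_algebra (space M) ?P (seq_borel \<Otimes>\<^sub>M seq_borel))"
        using in_vimage_algebra[OF measurable_sets[OF \<phi> A]] by blast
    qed
    then show "sets (vimage_algebra (space M) (\<lambda>\<omega>. \<phi> (?P \<omega>)) seq_borel) \<subseteq> events"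
      using indep_setD_ev2[OF xi_indep_U_W] by blast
    show "sets (vimage_algebra (space M) (\<lambda>\<omega> n. \<xi> n \<omega>) unit_seq) \<subseteq> events"
      by (rule indep_setD_ev1[OF xi_indep_U_W])
    show "prob (a \<inter> b) = prob a * prob b"
      if "a \<in> sets (vimage_algebra (space M) (\<lambda>\<omega>. \<phi> (?P \<omega>)) seq_borel)"
        "b \<in> sets (vimage_algebra (space M) (\<lambda>\<omega> n. \<xi> n \<omega>) unit_seq)" for a b
      using indep_setD[OF xi_indep_U_W that(2)] sub that(1) by (simp add: Int_commute mult.commute subset_iff)
  qed
  then show ?thesis
    unfolding indep_var_eq using m measurable_xi by (simp add: sets_vimage_algebra)
qed

lemma indep_U_xi: "indep_var seq_borel (\<lambda>\<omega> n. U n \<omega>) unit_seq (\<lambda>\<omega> n. \<xi> n \<omega>)"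
  and indep_W_xi: "indep_var seq_borel (\<lambda>\<omega> n. W n \<omega>) unit_seq (\<lambda>\<omega> n. \<xi> n \<omega>)"
  using indep_var_xi[OF measurable_fst] indep_var_xi[OF measurable_snd] by simp_all

end

locale hierarchical_dirichlet_pos = hierarchical_dirichlet +
  assumes alpha: "0 < \<alpha>" and beta: "0 < \<beta>" and nu: "\<nu>\<^sub>0 \<in> space (prob_algebra unit_borel)"
begin

sublocale B: unit_factors "\<lambda>_. beta_dist 1 \<alpha>"
  using alpha by (intro unit_factors_beta_dist) auto

lemma AE_U: "AE \<omega> in M. \<forall>k. 0 < U k \<omega> \<and> U k \<omega> < 1"
  by (rule AE_distrD[OF measurable_U]) (unfold distr_U, rule B.AE_unit)

lemma AE_prob_vector_U: "AE \<omega> in M. prob_vector (stick (\<lambda>k. U k \<omega>))"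
  by (rule AE_distrD[OF measurable_U]) (unfold distr_U, rule AE_prob_vector_iid[OF alpha])

lemma nn_integral_U:
  "h \<in> borel_measurable seq_borel \<Longrightarrow>
    (\<integral>\<^sup>+\<omega>. h (\<lambda>n. U n \<omega>) \<partial>M) = (\<integral>\<^sup>+u. h u \<partial>(\<Pi>\<^sub>M n\<in>(UNIV::nat set). beta_dist 1 \<alpha>))"
  unfolding distr_U[symmetric] by (rule nn_integral_distr[symmetric]) auto

abbreviation W_law :: "(nat \<Rightarrow> real) \<Rightarrow> (nat \<Rightarrow> real) measure" where
  "W_law v \<equiv> \<Pi>\<^sub>M n\<in>UNIV. beta_dist (\<beta> * v n) (\<beta> * (1 - (\<Sum>k\<le>n. v k)))"

lemma nn_integral_W:
  assumes "h \<in> borel_measurable seq_borel"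
  shows "(\<integral>\<^sup>+\<omega>. h (\<lambda>n. W n \<omega>) \<partial>M) = (\<integral>\<^sup>+\<omega>. (\<integral>\<^sup>+w. h w \<partial>W_law (stick (\<lambda>k. U k \<omega>))) \<partial>M)"
proof (rule nn_integral_cond_law[OF prob_space_axioms W_cond_law _ assms])
  \<comment> \<open>The kernel is controlled only at realisations with all \<open>U k\<close>
    strictly between 0 and 1, where the Beta parameters are positive.\<close>
  show "AE \<omega> in M. prob_space (W_law (stick (\<lambda>k. U k \<omega>))) \<and> sets (W_law (stick (\<lambda>k. U k \<omega>))) = sets seq_borel"
    using AE_U
  proof eventually_elim
    case (elim \<omega>)
    then interpret stick_conditional "\<lambda>k. U k \<omega>" \<beta>
      using beta by unfold_locales auto
    show ?case using P.prob_space_axioms sets_PiM by blast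
  qed
qed

text \<open>The conditional law transports integrals, so the claim is phrased as the vanishing of
  the integral of \<open>h\<close>, the indicator of the exceptional set.\<close>

lemma AE_W: "AE \<omega> in M. \<forall>k. 0 < W k \<omega> \<and> W k \<omega> < 1"
proof -
  define h :: "(nat \<Rightarrow> real) \<Rightarrow> ennreal" where "h w = (if \<forall>k. 0 < w k \<and> w k < 1 then 0 else 1)" for w
  have h [measurable]: "h \<in> borel_measurable seq_borel" unfolding h_def by measurable
  have "(\<integral>\<^sup>+\<omega>. h (\<lambda>n. W n \<omega>) \<partial>M) = (\<integral>\<^sup>+\<omega>. 0 \<partial>M)"
    unfolding nn_integral_W[OF h]
  proof (rule nn_integral_cong_AE)
    show "AE \<omega> in M. (\<integral>\<^sup>+w. h w \<partial>W_law (stick (\<lambda>k. U k \<omega>))) = 0"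
      using AE_U
    proof eventually_elim
      case (elim \<omega>)
      then interpret stick_conditional "\<lambda>k. U k \<omega>" \<beta>
        using beta by unfold_locales auto
      have "(\<integral>\<^sup>+w. h w \<partial>W_law (stick (\<lambda>k. U k \<omega>))) = (\<integral>\<^sup>+w. 0 \<partial>W_law (stick (\<lambda>k. U k \<omega>)))"
        using AE_unit by (intro nn_integral_cong_AE) (auto simp: h_def elim!: eventually_mono)
      then show ?case by simp
    qed
  qed
  then have "(\<integral>\<^sup>+\<omega>. h (\<lambda>n. W n \<omega>) \<partial>M) = 0" by simp
  then have "AE \<omega> in M. h (\<lambda>n. W n \<omega>) = 0"
    by (subst (asm) nn_integral_0_iff_AE) measurable
  then show ?thesis by eventually_elim (auto simp: h_def split: if_splits)
qed

text \<open>Given U, the remainders at level two have the level one remainders as means. Their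
  expected sum is therefore the same \<open>1 + \<alpha>\<close>, whatever \<beta> is.\<close>

lemma AE_prob_vector_W: "AE \<omega> in M. prob_vector (stick (\<lambda>k. W k \<omega>))"
proof -
  let ?h = "\<lambda>w::nat \<Rightarrow> real. \<Sum>n. ennreal (\<Prod>k<n. 1 - w k)"
  have h: "?h \<in> borel_measurable seq_borel" by measurable
  have "(\<integral>\<^sup>+\<omega>. ?h (\<lambda>n. W n \<omega>) \<partial>M) = (\<integral>\<^sup>+\<omega>. ?h (\<lambda>n. U n \<omega>) \<partial>M)"
    unfolding nn_integral_W[OF h]
  proof (rule nn_integral_cong_AE)
    show "AE \<omega> in M. (\<integral>\<^sup>+w. ?h w \<partial>W_law (stick (\<lambda>k. U k \<omega>))) = ?h (\<lambda>n. U n \<omega>)"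
      using AE_U
    proof eventually_elim
      case (elim \<omega>)
      then interpret stick_conditional "\<lambda>k. U k \<omega>" \<beta>
        using beta by unfold_locales auto
      show ?case
        by (subst nn_integral_suminf) (simp_all add: remainder measurable_cong_sets[OF sets_PiM refl])
    qed
  qed
  also have "\<dots> = ennreal (1 + \<alpha>)"
    unfolding nn_integral_U[OF h] by (rule remainder_sum_iid[OF alpha])
  finally have fin: "(\<integral>\<^sup>+\<omega>. ?h (\<lambda>n. W n \<omega>) \<partial>M) \<noteq> top" by simp
  have "AE w in distr M seq_borel (\<lambda>\<omega> n. W n \<omega>). prob_vector (stick w)"
  proof (rule AE_prob_vector_stick)
    show "AE w in distr M seq_borel (\<lambda>\<omega> n. W n \<omega>). \<forall>k. 0 \<le> w k \<and> w k \<le> 1"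
      using AE_W by (subst AE_distr_iff) (auto elim!: eventually_mono intro: less_imp_le)
    show "(\<integral>\<^sup>+w. ?h w \<partial>distr M seq_borel (\<lambda>\<omega> n. W n \<omega>)) \<noteq> top"
      using fin by (subst nn_integral_distr) auto
  qed simp
  then show ?thesis by (rule AE_distrD[OF measurable_W])
qed

lemma stick_square_U: "(\<integral>\<^sup>+\<omega>. (\<Sum>n. ennreal ((stick (\<lambda>k. U k \<omega>) n)\<^sup>2)) \<partial>M) = ennreal (1 / (1 + \<alpha>))"
  by (subst nn_integral_U) (auto simp: stick_square_iid alpha)

lemma stick_square_W:
  "(\<integral>\<^sup>+\<omega>. (\<Sum>n. ennreal ((stick (\<lambda>k. W k \<omega>) n)\<^sup>2)) \<partial>M) \<le> ennreal (1 / (1 + \<alpha>) + 1 / (1 + \<beta>))"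
proof -
  let ?h = "\<lambda>w. \<Sum>n. ennreal ((stick w n)\<^sup>2)"
  have h: "?h \<in> borel_measurable seq_borel" by measurable
  have "(\<integral>\<^sup>+\<omega>. ?h (\<lambda>n. W n \<omega>) \<partial>M) \<le> (\<integral>\<^sup>+\<omega>. ?h (\<lambda>n. U n \<omega>) + ennreal (1 / (1 + \<beta>)) \<partial>M)"
    unfolding nn_integral_W[OF h]
  proof (rule nn_integral_mono_AE)
    show "AE \<omega> in M. (\<integral>\<^sup>+w. ?h w \<partial>W_law (stick (\<lambda>k. U k \<omega>))) \<le> ?h (\<lambda>n. U n \<omega>) + ennreal (1 / (1 + \<beta>))"
      using AE_U AE_prob_vector_U
    proof eventually_elim
      case (elim \<omega>)
      then interpret stick_conditional "\<lambda>k. U k \<omega>" \<beta>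
        using beta by unfold_locales auto
      show ?case using elim by (intro sum_stick_square)
    qed
  qed
  also have "\<dots> = (\<integral>\<^sup>+\<omega>. ?h (\<lambda>n. U n \<omega>) \<partial>M) + ennreal (1 / (1 + \<beta>))"
    by (subst nn_integral_add) (auto simp: emeasure_space_1)
  also have "\<dots> = ennreal (1 / (1 + \<alpha>) + 1 / (1 + \<beta>))"
    using alpha beta by (simp add: stick_square_U)
  finally show ?thesis .
qed

context
  fixes g :: "real \<Rightarrow> real" and C :: real
  assumes g: "g \<in> borel_measurable unit_borel" and C: "\<And>y. y \<in> {0..1} \<Longrightarrow> \<bar>g y\<bar> \<le> C"
begin

abbreviation "deviation N \<equiv> (\<integral>y. g y \<partial>N) - (\<integral>y. g y \<partial>\<nu>\<^sub>0)"

lemma atomic_W_second_moment: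
  "(\<integral>\<^sup>+\<omega>. ennreal ((deviation (atomic (stick (\<lambda>k. W k \<omega>)) (\<lambda>n. \<xi> n \<omega>)))\<^sup>2) \<partial>M)
    \<le> ennreal (4 * C\<^sup>2 * (1 / (1 + \<alpha>) + 1 / (1 + \<beta>)))"
proof -
  have "(\<integral>\<^sup>+\<omega>. ennreal ((deviation (atomic (stick (\<lambda>k. W k \<omega>)) (\<lambda>n. \<xi> n \<omega>)))\<^sup>2) \<partial>M)
    \<le> ennreal (4 * C\<^sup>2) * (\<integral>\<^sup>+\<omega>. (\<Sum>n. ennreal ((stick (\<lambda>k. W k \<omega>) n)\<^sup>2)) \<partial>M)"
    by (rule independent_atomic_second_moment[OF nu g C indep_W_xi distr_xi AE_prob_vector_W])
  also have "\<dots> \<le> ennreal (4 * C\<^sup>2) * ennreal (1 / (1 + \<alpha>) + 1 / (1 + \<beta>))"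
    by (intro mult_left_mono stick_square_W) simp
  also have "\<dots> = ennreal (4 * C\<^sup>2 * (1 / (1 + \<alpha>) + 1 / (1 + \<beta>)))"
    using alpha beta by (intro ennreal_mult[symmetric]) auto
  finally show ?thesis .
qed

text \<open>The deviation is split at the intermediate measure \<open>?Y \<omega>\<close> by (a +
  b)^2 \<le> 2 a^2 + 2 b^2. Each part obeys the bound with constant 4, and the splitting doubles it
  to 8.\<close>

lemma Xi_second_moment:
  "(\<integral>\<^sup>+\<omega>. ennreal ((deviation (\<Xi> \<omega>))\<^sup>2) \<partial>M) \<le> ennreal (8 * C\<^sup>2 * (1 / (1 + \<alpha>) + 1 / (1 + \<beta>)))"
proof -
  have two: "2 * ennreal a = ennreal (2 * a)" if "0 \<le> a" for a
    using that by (simp add: ennreal_mult)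
  let ?Y = "\<lambda>\<omega>. atomic (stick (\<lambda>k. U k \<omega>)) (\<lambda>n. \<xi> n \<omega>)"
  have Y: "?Y \<in> M \<rightarrow>\<^sub>M prob_algebra unit_borel"
    using Xi_cond_law by (simp add: has_cond_law_def)
  have [measurable]: "(\<lambda>N. \<integral>y. g y \<partial>N) \<in> borel_measurable (prob_algebra unit_borel)"
    by (rule measurable_integral_prob_algebra[OF g])
  have h: "(\<lambda>N. ennreal ((deviation N)\<^sup>2)) \<in> borel_measurable (prob_algebra unit_borel)"
    by measurable
  \<comment> \<open>The default branch of \<open>atomic\<close> keeps \<open>?Y \<omega>\<close> a
    probability measure for every \<open>\<omega>\<close> in the space, so the conditions on the
    kernel hold everywhere and not just almost surely.\<close>
  have "(\<integral>\<^sup>+\<omega>. ennreal ((deviation (\<Xi> \<omega>))\<^sup>2) \<partial>M)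
    = (\<integral>\<^sup>+\<omega>. (\<integral>\<^sup>+N. ennreal ((deviation N)\<^sup>2) \<partial>dirichlet_process_law \<beta> (?Y \<omega>)) \<partial>M)"
    using measurable_space[OF Y] beta
    by (intro nn_integral_cond_law[OF prob_space_axioms Xi_cond_law _ h] AE_I2 conjI dirichlet_process_law_prob) auto
  also have "\<dots> \<le> (\<integral>\<^sup>+\<omega>. 2 * ennreal ((deviation (?Y \<omega>))\<^sup>2) + ennreal (8 * C\<^sup>2 / (1 + \<beta>)) \<partial>M)"
  proof (rule nn_integral_mono)
    fix \<omega> assume "\<omega> \<in> space M"
    define \<mu> where "\<mu> = ?Y \<omega>"
    have \<mu>: "\<mu> \<in> space (prob_algebra unit_borel)"
      using measurable_space[OF Y \<open>\<omega> \<in> space M\<close>] by (simp add: \<mu>_def)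
    let ?L = "dirichlet_process_law \<beta> \<mu>"
    interpret L: prob_space ?L by (rule dirichlet_process_law_prob(2)[OF \<mu> beta])
    have [measurable_cong]: "sets ?L = sets (prob_algebra unit_borel)"
      by (rule dirichlet_process_law_prob(3)[OF \<mu> beta])
    have "(\<integral>\<^sup>+N. ennreal ((deviation N)\<^sup>2) \<partial>?L)
      \<le> (\<integral>\<^sup>+N. 2 * ennreal ((deviation \<mu>)\<^sup>2) + 2 * ennreal (((\<integral>y. g y \<partial>N) - (\<integral>y. g y \<partial>\<mu>))\<^sup>2) \<partial>?L)"
    proof (rule nn_integral_mono)
      fix N
      have *: "(a + b)\<^sup>2 \<le> 2 * a\<^sup>2 + 2 * b\<^sup>2" for a b :: real
        using zero_le_power2[of "a - b"] by (simp add: power2_eq_square algebra_simps)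
      have "(deviation N)\<^sup>2 \<le> 2 * (deviation \<mu>)\<^sup>2 + 2 * ((\<integral>y. g y \<partial>N) - (\<integral>y. g y \<partial>\<mu>))\<^sup>2"
        using *[of "deviation \<mu>" "(\<integral>y. g y \<partial>N) - (\<integral>y. g y \<partial>\<mu>)"] by simp
      moreover have "ennreal (2 * a + 2 * b) = 2 * ennreal a + 2 * ennreal b" if "0 \<le> a" "0 \<le> b" for a b
        using that by (simp add: ennreal_mult)
      ultimately show "ennreal ((deviation N)\<^sup>2) \<le> 2 * ennreal ((deviation \<mu>)\<^sup>2) + 2 * ennreal (((\<integral>y. g y \<partial>N) - (\<integral>y. g y \<partial>\<mu>))\<^sup>2)"
        by (metis ennreal_leI zero_le_power2)
    qed
    also have "\<dots> = 2 * ennreal ((deviation \<mu>)\<^sup>2)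
        + 2 * (\<integral>\<^sup>+N. ennreal (((\<integral>y. g y \<partial>N) - (\<integral>y. g y \<partial>\<mu>))\<^sup>2) \<partial>?L)"
      by (simp add: nn_integral_add nn_integral_cmult L.emeasure_space_1)
    also have "\<dots> \<le> 2 * ennreal ((deviation \<mu>)\<^sup>2) + 2 * ennreal (4 * C\<^sup>2 / (1 + \<beta>))"
      by (intro add_left_mono mult_left_mono dirichlet_process_second_moment \<mu> beta g C) auto
    also have "2 * ennreal (4 * C\<^sup>2 / (1 + \<beta>)) = ennreal (8 * C\<^sup>2 / (1 + \<beta>))"
      using beta by (subst two) auto
    finally show "(\<integral>\<^sup>+N. ennreal ((deviation N)\<^sup>2) \<partial>dirichlet_process_law \<beta> (?Y \<omega>))
       \<le> 2 * ennreal ((deviation (?Y \<omega>))\<^sup>2) + ennreal (8 * C\<^sup>2 / (1 + \<beta>))"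
      by (simp only: \<mu>_def)
  qed
  also have "\<dots> = 2 * (\<integral>\<^sup>+\<omega>. ennreal ((deviation (?Y \<omega>))\<^sup>2) \<partial>M) + ennreal (8 * C\<^sup>2 / (1 + \<beta>))"
    using measurable_compose[OF Y h] by (simp add: nn_integral_add nn_integral_cmult emeasure_space_1)
  also have "\<dots> \<le> 2 * (ennreal (4 * C\<^sup>2) * ennreal (1 / (1 + \<alpha>))) + ennreal (8 * C\<^sup>2 / (1 + \<beta>))"
    using independent_atomic_second_moment[OF nu g C indep_U_xi distr_xi AE_prob_vector_U]
    by (intro add_right_mono mult_left_mono) (simp_all only: stick_square_U zero_le)
  also have "2 * (ennreal (4 * C\<^sup>2) * ennreal (1 / (1 + \<alpha>))) = ennreal (8 * C\<^sup>2 / (1 + \<alpha>))"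
    using alpha by (subst ennreal_mult[symmetric]) (auto simp: two)
  also have "ennreal (8 * C\<^sup>2 / (1 + \<alpha>)) + ennreal (8 * C\<^sup>2 / (1 + \<beta>)) = ennreal (8 * C\<^sup>2 * (1 / (1 + \<alpha>) + 1 / (1 + \<beta>)))"
    using alpha beta by (subst ennreal_plus[symmetric]) (auto simp: algebra_simps)
  finally show ?thesis .
qed

end

lemma measurable_Xi: "\<Xi> \<in> M \<rightarrow>\<^sub>M prob_algebra unit_borel"
  using Xi_cond_law by (simp add: has_cond_law_def)

lemma measurable_atomic_W:
  "(\<lambda>\<omega>. atomic (stick (\<lambda>k. W k \<omega>)) (\<lambda>n. \<xi> n \<omega>)) \<in> M \<rightarrow>\<^sub>M prob_algebra unit_borel"
  using measurable_compose[OF measurable_Pair[OF measurable_W measurable_xi] measurable_atomic_stick] by simp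

text \<open>A single term is dominated by the whole sum, which gives a bound independent of
  \<open>j\<close>.\<close>

lemma stick_W_second_moment:
  "(\<integral>\<^sup>+\<omega>. ennreal ((stick (\<lambda>k. W k \<omega>) j)\<^sup>2) \<partial>M) \<le> ennreal (1 / (1 + \<alpha>) + 1 / (1 + \<beta>))"
proof -
  have "(\<integral>\<^sup>+\<omega>. ennreal ((stick (\<lambda>k. W k \<omega>) j)\<^sup>2) \<partial>M) \<le> (\<integral>\<^sup>+\<omega>. (\<Sum>n. ennreal ((stick (\<lambda>k. W k \<omega>) n)\<^sup>2)) \<partial>M)"
  proof (rule nn_integral_mono)
    fix \<omega>
    have "ennreal ((stick (\<lambda>k. W k \<omega>) j)\<^sup>2) = (\<Sum>n\<in>{j}. ennreal ((stick (\<lambda>k. W k \<omega>) n)\<^sup>2))" by simp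
    also have "\<dots> \<le> (\<Sum>n. ennreal ((stick (\<lambda>k. W k \<omega>) n)\<^sup>2))"
      by (intro sum_le_suminf summableI) simp_all
    finally show "ennreal ((stick (\<lambda>k. W k \<omega>) j)\<^sup>2) \<le> (\<Sum>n. ennreal ((stick (\<lambda>k. W k \<omega>) n)\<^sup>2))" .
  qed
  with stick_square_W show ?thesis by (rule order_trans[rotated])
qed

end

section \<open>Convergence in probability\<close>

text \<open>The first n terms contribute at most e because the weights sum to 1; after them the
  truncation at 1 leaves at most the remaining weight \<open>(1/2) ^ n\<close>.\<close>

lemma weighted_min_series_le:
  fixes d :: "nat \<Rightarrow> real"
  assumes "0 \<le> e" and d: "\<And>j. j < n \<Longrightarrow> \<bar>d j\<bar> \<le> e"
  shows "(\<Sum>j. (1/2) ^ Suc j * min \<bar>d j\<bar> 1) \<le> e + (1/2) ^ n"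
proof -
  define b :: "nat \<Rightarrow> real" where "b j = (if j < n then 0 else (1/2) ^ Suc j)" for j
  have "(\<lambda>j. (1/2::real) ^ n * (1/2) ^ Suc j) sums ((1/2) ^ n * 1)"
    by (intro sums_mult power_half_series)
  then have "(\<lambda>j. b (j + n)) sums (1/2) ^ n"
    by (simp add: b_def power_add mult_ac)
  then have b: "b sums (1/2) ^ n"
    by (subst (asm) sums_zero_iff_shift) (auto simp: b_def)
  have le: "(1/2) ^ Suc j * min \<bar>d j\<bar> 1 \<le> (1/2) ^ Suc j * e + b j" for j
  proof (cases "j < n")
    case True
    then show ?thesis using d[OF True] by (auto simp: b_def min_def intro!: mult_left_mono)
  next
    case False
    have "(1/2) ^ Suc j * min \<bar>d j\<bar> 1 \<le> (1/2) ^ Suc j" by (intro mult_left_le) auto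
    also have "\<dots> \<le> (1/2) ^ Suc j * e + (1/2) ^ Suc j" using \<open>0 \<le> e\<close> by simp
    finally show ?thesis using False by (simp only: b_def if_False)
  qed
  have s: "(\<lambda>j. (1/2) ^ Suc j * e + b j) sums (1 * e + (1/2) ^ n)"
    by (intro sums_add sums_mult2 power_half_series b)
  have "summable (\<lambda>j. (1/2) ^ Suc j * min \<bar>d j\<bar> 1)"
    by (rule summable_comparison_test'[OF sums_summable[OF power_half_series]])
      (auto simp: abs_mult intro!: mult_left_le)
  then show ?thesis
    using suminf_le[OF le _ sums_summable[OF s]] sums_unique[OF s] by simp
qed

text \<open>Chebyshev's inequality, with the second moment in \<open>ennreal\<close> so that the
  estimates above can be inserted as they stand.\<close>

lemma (in prob_space) prob_abs_gt_le:
  fixes X :: "'a \<Rightarrow> real"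
  assumes [measurable]: "X \<in> borel_measurable M"
    and bound: "(\<integral>\<^sup>+\<omega>. ennreal ((X \<omega>)\<^sup>2) \<partial>M) \<le> ennreal c" and "0 \<le> c" "0 < e"
  shows "prob {\<omega> \<in> space M. \<bar>X \<omega>\<bar> > e} \<le> c / e\<^sup>2"
proof -
  have "emeasure M {\<omega> \<in> space M. \<bar>X \<omega>\<bar> > e}
      \<le> emeasure M {\<omega> \<in> space M. 1 \<le> ennreal (1 / e\<^sup>2) * ennreal ((X \<omega>)\<^sup>2)}"
  proof (intro emeasure_mono subsetI)
    fix \<omega> assume *: "\<omega> \<in> {\<omega> \<in> space M. \<bar>X \<omega>\<bar> > e}"
    then have "e\<^sup>2 \<le> (X \<omega>)\<^sup>2" using \<open>0 < e\<close> by (simp add: abs_le_square_iff[symmetric])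
    then have "1 \<le> 1 / e\<^sup>2 * (X \<omega>)\<^sup>2" using \<open>0 < e\<close> by (simp add: field_simps)
    then show "\<omega> \<in> {\<omega> \<in> space M. 1 \<le> ennreal (1 / e\<^sup>2) * ennreal ((X \<omega>)\<^sup>2)}"
      using * by (simp add: ennreal_mult[symmetric] flip: ennreal_1)
  qed simp
  also have "\<dots> \<le> ennreal (1 / e\<^sup>2) * (\<integral>\<^sup>+\<omega>. ennreal ((X \<omega>)\<^sup>2) * indicator (space M) \<omega> \<partial>M)"
    by (intro nn_integral_Markov_inequality) auto
  also have "(\<integral>\<^sup>+\<omega>. ennreal ((X \<omega>)\<^sup>2) * indicator (space M) \<omega> \<partial>M) = (\<integral>\<^sup>+\<omega>. ennreal ((X \<omega>)\<^sup>2) \<partial>M)"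
    by (intro nn_integral_cong) simp
  also have "ennreal (1 / e\<^sup>2) * \<dots> \<le> ennreal (1 / e\<^sup>2) * ennreal c"
    by (intro mult_left_mono bound) simp
  also have "\<dots> = ennreal (c / e\<^sup>2)" using \<open>0 \<le> c\<close> by (simp add: ennreal_mult[symmetric])
  finally show ?thesis using \<open>0 \<le> c\<close> by (simp add: emeasure_eq_measure)
qed

text \<open>Both metrics have this form. With n chosen so that the tail is below \<epsilon>/2, a
  value above \<epsilon> forces one of the first n coordinates above \<epsilon>/2; a union bound and
  Chebyshev's inequality finish. As n is fixed before the limit, the constants \<open>c j\<close>
  may depend on j.\<close>

lemma weighted_min_series_tendsto_prob:
  fixes M :: "'i \<Rightarrow> 'a measure" and D :: "'i \<Rightarrow> nat \<Rightarrow> 'a \<Rightarrow> real"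
  assumes ev: "\<forall>\<^sub>F i in F. prob_space (M i) \<and> (\<forall>j. D i j \<in> borel_measurable (M i)) \<and> 0 \<le> r i \<and>
      (\<forall>j. (\<integral>\<^sup>+\<omega>. ennreal ((D i j \<omega>)\<^sup>2) \<partial>M i) \<le> ennreal (c j * r i))"
    and c: "\<And>j. 0 \<le> c j" and r: "(r \<longlongrightarrow> 0) F" and "0 < \<epsilon>"
  shows "((\<lambda>i. measure (M i) {\<omega> \<in> space (M i). (\<Sum>j. (1/2) ^ Suc j * min \<bar>D i j \<omega>\<bar> 1) > \<epsilon>}) \<longlongrightarrow> 0) F"
proof -
  obtain n where n: "(1/2::real) ^ n < \<epsilon> / 2"
    using real_arch_pow_inv[of "\<epsilon>/2" "1/2"] \<open>0 < \<epsilon>\<close> by auto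
  have "\<forall>\<^sub>F i in F. measure (M i) {\<omega> \<in> space (M i). (\<Sum>j. (1/2) ^ Suc j * min \<bar>D i j \<omega>\<bar> 1) > \<epsilon>}
      \<le> (\<Sum>j<n. c j * r i / (\<epsilon> / 2)\<^sup>2)"
    using ev
  proof eventually_elim
    case (elim i)
    then interpret prob_space "M i" by simp
    have [measurable]: "D i j \<in> borel_measurable (M i)" for j using elim by simp
    let ?A = "\<lambda>j. {\<omega> \<in> space (M i). \<bar>D i j \<omega>\<bar> > \<epsilon> / 2}"
    have "measure (M i) {\<omega> \<in> space (M i). (\<Sum>j. (1/2) ^ Suc j * min \<bar>D i j \<omega>\<bar> 1) > \<epsilon>}
        \<le> measure (M i) (\<Union>j<n. ?A j)"
    proof (intro finite_measure_mono subsetI)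
      fix \<omega> assume \<omega>: "\<omega> \<in> {\<omega> \<in> space (M i). (\<Sum>j. (1/2) ^ Suc j * min \<bar>D i j \<omega>\<bar> 1) > \<epsilon>}"
      show "\<omega> \<in> (\<Union>j<n. ?A j)"
      proof (rule ccontr)
        assume "\<omega> \<notin> (\<Union>j<n. ?A j)"
        then have "\<bar>D i j \<omega>\<bar> \<le> \<epsilon> / 2" if "j < n" for j using \<omega> that by force
        then have "(\<Sum>j. (1/2) ^ Suc j * min \<bar>D i j \<omega>\<bar> 1) \<le> \<epsilon> / 2 + (1/2) ^ n"
          using \<open>0 < \<epsilon>\<close> by (intro weighted_min_series_le) simp_all
        moreover have "\<epsilon> < (\<Sum>j. (1/2) ^ Suc j * min \<bar>D i j \<omega>\<bar> 1)" using \<omega> by blast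
        ultimately show False using n by linarith
      qed
    qed measurable
    also have "\<dots> \<le> (\<Sum>j<n. measure (M i) (?A j))"
      by (intro finite_measure_subadditive_finite) auto
    also have "\<dots> \<le> (\<Sum>j<n. c j * r i / (\<epsilon> / 2)\<^sup>2)"
    proof (intro sum_mono prob_abs_gt_le)
      show "(\<integral>\<^sup>+\<omega>. ennreal ((D i j \<omega>)\<^sup>2) \<partial>M i) \<le> ennreal (c j * r i)" for j using elim by blast
      show "0 \<le> c j * r i" for j using elim c by (intro mult_nonneg_nonneg) blast+
    qed (use \<open>0 < \<epsilon>\<close> in simp_all)
    finally show ?case .
  qed
  moreover have "((\<lambda>i. \<Sum>j<n. c j * r i / (\<epsilon> / 2)\<^sup>2) \<longlongrightarrow> 0) F"
    by (intro tendsto_null_sum tendsto_divide_zero tendsto_mult_right_zero r)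
  ultimately show ?thesis
    by (rule tendsto_sandwich[OF always_eventually[OF allI[OF measure_nonneg]] _ tendsto_const])
qed

text \<open>Stated for general random measures since it serves twice, for \<open>\<Xi>\<close> and
  for the series with masses Z.\<close>

lemma rho_tendsto_prob:
  fixes M :: "'i \<Rightarrow> 'a measure" and f :: "nat \<Rightarrow> real \<Rightarrow> real"
  assumes \<nu>: "\<nu> \<in> space (prob_algebra unit_borel)" and f: "\<And>j. f j \<in> borel_measurable unit_borel"
    and ev: "\<forall>\<^sub>F i in F. prob_space (M i) \<and> X i \<in> M i \<rightarrow>\<^sub>M prob_algebra unit_borel \<and> 0 \<le> r i \<and>
      (\<forall>j. (\<integral>\<^sup>+\<omega>. ennreal (((\<integral>y. f j y \<partial>X i \<omega>) - (\<integral>y. f j y \<partial>\<nu>))\<^sup>2) \<partial>M i) \<le> ennreal (c j * r i))"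
    and c: "\<And>j. 0 \<le> c j" and r: "(r \<longlongrightarrow> 0) F"
  shows "converges_in_prob F M (space (prob_algebra unit_borel)) (rho f) X \<nu>"
  unfolding converges_in_prob_def
proof (intro conjI allI impI \<nu>)
  have m: "(\<lambda>\<omega>. (\<integral>y. f j y \<partial>X i \<omega>) - (\<integral>y. f j y \<partial>\<nu>)) \<in> borel_measurable (M i)"
    if "X i \<in> M i \<rightarrow>\<^sub>M prob_algebra unit_borel" for i j
    using measurable_compose[OF that measurable_integral_prob_algebra[OF f, of j]] by measurable
  show "\<forall>\<^sub>F i in F. (AE \<omega> in M i. X i \<omega> \<in> space (prob_algebra unit_borel)) \<and>
      (\<lambda>\<omega>. rho f (X i \<omega>) \<nu>) \<in> borel_measurable (M i)"
    using ev
  proof eventually_elim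
    case (elim i)
    then have [measurable]: "(\<lambda>\<omega>. (\<integral>y. f j y \<partial>X i \<omega>) - (\<integral>y. f j y \<partial>\<nu>)) \<in> borel_measurable (M i)" for j
      by (intro m) auto
    show ?case
      unfolding rho_def
    proof
      show "AE \<omega> in M i. X i \<omega> \<in> space (prob_algebra unit_borel)"
        using elim by (intro AE_I2 measurable_space[of "X i"]) auto
    qed measurable
  qed
  fix \<epsilon> :: real assume "0 < \<epsilon>"
  show "((\<lambda>i. measure (M i) {\<omega> \<in> space (M i). \<epsilon> < rho f (X i \<omega>) \<nu>}) \<longlongrightarrow> 0) F"
    unfolding rho_def
  proof (rule weighted_min_series_tendsto_prob[OF _ c r \<open>0 < \<epsilon>\<close>])
    show "\<forall>\<^sub>F i in F. prob_space (M i) \<and>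
        (\<forall>j. (\<lambda>\<omega>. (\<integral>y. f j y \<partial>X i \<omega>) - (\<integral>y. f j y \<partial>\<nu>)) \<in> borel_measurable (M i)) \<and> 0 \<le> r i \<and>
        (\<forall>j. (\<integral>\<^sup>+\<omega>. ennreal (((\<integral>y. f j y \<partial>X i \<omega>) - (\<integral>y. f j y \<partial>\<nu>))\<^sup>2) \<partial>M i) \<le> ennreal (c j * r i))"
      using ev by eventually_elim (simp add: m)
  qed
qed

text \<open>The product filter lets \<alpha> and \<beta> grow without any relation between their
  rates. The hierarchical process appears both through its conditional law and as the series with
  masses Z; these are different random measures on the same space, so each gets its own convergence
  statement.\<close>

theorem theorem3p1:
  fixes M :: "real \<Rightarrow> real \<Rightarrow> 'a measure"
    and \<nu>\<^sub>0 :: "real measure"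
    and \<xi> U W :: "real \<Rightarrow> real \<Rightarrow> nat \<Rightarrow> 'a \<Rightarrow> real"
    and \<Xi> :: "real \<Rightarrow> real \<Rightarrow> 'a \<Rightarrow> real measure"
    and f :: "nat \<Rightarrow> real \<Rightarrow> real"
  assumes "\<nu>\<^sub>0 \<in> space (prob_algebra unit_borel)"
    and "dense_in_C f"
    and "\<And>\<alpha> \<beta>. \<alpha> > 0 \<Longrightarrow> \<beta> > 0 \<Longrightarrow>
      hierarchical_dirichlet (M \<alpha> \<beta>) \<alpha> \<beta> \<nu>\<^sub>0 (\<xi> \<alpha> \<beta>) (U \<alpha> \<beta>) (W \<alpha> \<beta>) (\<Xi> \<alpha> \<beta>)"
  shows "converges_in_prob (at_top \<times>\<^sub>F at_top) (\<lambda>(\<alpha>, \<beta>). M \<alpha> \<beta>) triangle_inf dist_inf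
      (\<lambda>(\<alpha>, \<beta>) \<omega>. stick (\<lambda>k. W \<alpha> \<beta> k \<omega>)) (\<lambda>_. 0)
    \<and> converges_in_prob (at_top \<times>\<^sub>F at_top) (\<lambda>(\<alpha>, \<beta>). M \<alpha> \<beta>)
      (space (prob_algebra unit_borel)) (rho f) (\<lambda>(\<alpha>, \<beta>). \<Xi> \<alpha> \<beta>) \<nu>\<^sub>0
    \<and> converges_in_prob (at_top \<times>\<^sub>F at_top) (\<lambda>(\<alpha>, \<beta>). M \<alpha> \<beta>)
      (space (prob_algebra unit_borel)) (rho f)
      (\<lambda>(\<alpha>, \<beta>) \<omega>. atomic (stick (\<lambda>k. W \<alpha> \<beta> k \<omega>)) (\<lambda>n. \<xi> \<alpha> \<beta> n \<omega>)) \<nu>\<^sub>0"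
proof -
  let ?F = "at_top \<times>\<^sub>F at_top :: (real \<times> real) filter"
  \<comment> \<open>The common rate of all second moment bounds: one summand from each
    level.\<close>
  define r :: "real \<times> real \<Rightarrow> real" where "r i = 1 / (1 + fst i) + 1 / (1 + snd i)" for i
  have lim: "((\<lambda>a::real. 1 / (1 + a)) \<longlongrightarrow> 0) at_top"
    by (intro tendsto_divide_0[OF tendsto_const] filterlim_at_top_imp_at_infinity
        filterlim_tendsto_add_at_top[OF tendsto_const] filterlim_ident)
  have "(r \<longlongrightarrow> 0 + 0) ?F"
    unfolding r_def
    by (intro tendsto_add filterlim_compose[OF lim] filterlim_fst filterlim_snd)
  then have r: "(r \<longlongrightarrow> 0) ?F" by simp
  have pos: "hierarchical_dirichlet_pos (M (fst i) (snd i)) (fst i) (snd i) \<nu>\<^sub>0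
      (\<xi> (fst i) (snd i)) (U (fst i) (snd i)) (W (fst i) (snd i)) (\<Xi> (fst i) (snd i))"
    if "0 < fst i \<and> 0 < snd i" for i
    using that assms by (intro hierarchical_dirichlet_pos.intro hierarchical_dirichlet_pos_axioms.intro) auto
  have ev: "\<forall>\<^sub>F i in ?F. 0 < fst i \<and> 0 < snd i"
    by (intro eventually_conj eventually_compose_filterlim[OF eventually_gt_at_top] filterlim_fst filterlim_snd)
  have r_nonneg: "0 \<le> r i" if "0 < fst i \<and> 0 < snd i" for i
    using that by (simp add: r_def)
  have f: "continuous_on {0..1} (f j)" for j
    using assms(2) by (simp add: dense_in_C_def)
  have fm: "f j \<in> borel_measurable unit_borel" for j
    by (rule continuous_on_measurable_unit_borel[OF f])
  \<comment> \<open>Continuity on a compact interval bounds each test function; these bounds are the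
    source of the constants \<open>c j\<close>.\<close>
  have "\<exists>C. \<forall>y\<in>{0..1}. \<bar>f j y\<bar> \<le> C" for j
    using compact_imp_bounded[OF compact_continuous_image[OF f[of j] compact_Icc]]
    by (auto simp: bounded_iff)
  then obtain C where C: "\<And>j y. y \<in> {0..1} \<Longrightarrow> \<bar>f j y\<bar> \<le> C j" by metis
  have Z: "converges_in_prob ?F (\<lambda>i. M (fst i) (snd i)) triangle_inf dist_inf
      (\<lambda>i \<omega>. stick (\<lambda>k. W (fst i) (snd i) k \<omega>)) (\<lambda>_. 0)"
    unfolding converges_in_prob_def
  proof (intro conjI allI impI)
    show "(\<lambda>_. 0) \<in> triangle_inf" by (simp add: triangle_inf_def)
    have m: "(\<lambda>\<omega>. stick (\<lambda>k. W (fst i) (snd i) k \<omega>) j) \<in> borel_measurable (M (fst i) (snd i))"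
      if "0 < fst i \<and> 0 < snd i" for i j
    proof -
      interpret hierarchical_dirichlet_pos "M (fst i) (snd i)" "fst i" "snd i" \<nu>\<^sub>0
        "\<xi> (fst i) (snd i)" "U (fst i) (snd i)" "W (fst i) (snd i)" "\<Xi> (fst i) (snd i)"
        by (rule pos[OF that])
      show ?thesis by measurable
    qed
    show "\<forall>\<^sub>F i in ?F. (AE \<omega> in M (fst i) (snd i). stick (\<lambda>k. W (fst i) (snd i) k \<omega>) \<in> triangle_inf) \<and>
        (\<lambda>\<omega>. dist_inf (stick (\<lambda>k. W (fst i) (snd i) k \<omega>)) (\<lambda>_. 0)) \<in> borel_measurable (M (fst i) (snd i))"
      using ev
    proof eventually_elim
      case (elim i)
      interpret hierarchical_dirichlet_pos "M (fst i) (snd i)" "fst i" "snd i" \<nu>\<^sub>0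
        "\<xi> (fst i) (snd i)" "U (fst i) (snd i)" "W (fst i) (snd i)" "\<Xi> (fst i) (snd i)"
        by (rule pos[OF elim])
      note [measurable] = m[OF elim]
      show ?case
        unfolding dist_inf_def
        using AE_W by (auto elim!: eventually_mono intro!: stick_in_triangle_inf less_imp_le)
    qed
    fix \<epsilon> :: real assume "0 < \<epsilon>"
    show "((\<lambda>i. measure (M (fst i) (snd i)) {\<omega> \<in> space (M (fst i) (snd i)).
        \<epsilon> < dist_inf (stick (\<lambda>k. W (fst i) (snd i) k \<omega>)) (\<lambda>_. 0)}) \<longlongrightarrow> 0) ?F"
      unfolding dist_inf_def
    proof (rule weighted_min_series_tendsto_prob[where c = "\<lambda>_. 1", OF _ _ r \<open>0 < \<epsilon>\<close>])
      show "\<forall>\<^sub>F i in ?F. prob_space (M (fst i) (snd i)) \<and>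
          (\<forall>j. (\<lambda>\<omega>. stick (\<lambda>k. W (fst i) (snd i) k \<omega>) j - 0) \<in> borel_measurable (M (fst i) (snd i))) \<and> 0 \<le> r i \<and>
          (\<forall>j. (\<integral>\<^sup>+\<omega>. ennreal ((stick (\<lambda>k. W (fst i) (snd i) k \<omega>) j - 0)\<^sup>2) \<partial>M (fst i) (snd i)) \<le> ennreal (1 * r i))"
        using ev
      proof eventually_elim
        case (elim i)
        interpret hierarchical_dirichlet_pos "M (fst i) (snd i)" "fst i" "snd i" \<nu>\<^sub>0
          "\<xi> (fst i) (snd i)" "U (fst i) (snd i)" "W (fst i) (snd i)" "\<Xi> (fst i) (snd i)"
          by (rule pos[OF elim])
        show ?case
          using m[OF elim] r_nonneg[OF elim] stick_W_second_moment prob_space_axioms by (simp add: r_def)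
      qed
    qed simp
  qed
  have Xi: "converges_in_prob ?F (\<lambda>i. M (fst i) (snd i)) (space (prob_algebra unit_borel)) (rho f)
      (\<lambda>i. \<Xi> (fst i) (snd i)) \<nu>\<^sub>0"
  proof (rule rho_tendsto_prob[where c = "\<lambda>j. 8 * (C j)\<^sup>2", OF assms(1) fm _ _ r])
    show "\<forall>\<^sub>F i in ?F. prob_space (M (fst i) (snd i)) \<and>
        \<Xi> (fst i) (snd i) \<in> M (fst i) (snd i) \<rightarrow>\<^sub>M prob_algebra unit_borel \<and> 0 \<le> r i \<and>
        (\<forall>j. (\<integral>\<^sup>+\<omega>. ennreal (((\<integral>y. f j y \<partial>\<Xi> (fst i) (snd i) \<omega>) - (\<integral>y. f j y \<partial>\<nu>\<^sub>0))\<^sup>2) \<partial>M (fst i) (snd i))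
          \<le> ennreal (8 * (C j)\<^sup>2 * r i))"
      using ev
    proof eventually_elim
      case (elim i)
      interpret hierarchical_dirichlet_pos "M (fst i) (snd i)" "fst i" "snd i" \<nu>\<^sub>0
        "\<xi> (fst i) (snd i)" "U (fst i) (snd i)" "W (fst i) (snd i)" "\<Xi> (fst i) (snd i)"
        by (rule pos[OF elim])
      show ?case
        using Xi_second_moment[OF fm C] measurable_Xi r_nonneg[OF elim] prob_space_axioms
        unfolding r_def by blast
    qed
  qed simp
  have At: "converges_in_prob ?F (\<lambda>i. M (fst i) (snd i)) (space (prob_algebra unit_borel)) (rho f)
      (\<lambda>i \<omega>. atomic (stick (\<lambda>k. W (fst i) (snd i) k \<omega>)) (\<lambda>n. \<xi> (fst i) (snd i) n \<omega>)) \<nu>\<^sub>0"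
  proof (rule rho_tendsto_prob[where c = "\<lambda>j. 4 * (C j)\<^sup>2", OF assms(1) fm _ _ r])
    show "\<forall>\<^sub>F i in ?F. prob_space (M (fst i) (snd i)) \<and>
        (\<lambda>\<omega>. atomic (stick (\<lambda>k. W (fst i) (snd i) k \<omega>)) (\<lambda>n. \<xi> (fst i) (snd i) n \<omega>))
          \<in> M (fst i) (snd i) \<rightarrow>\<^sub>M prob_algebra unit_borel \<and> 0 \<le> r i \<and>
        (\<forall>j. (\<integral>\<^sup>+\<omega>. ennreal (((\<integral>y. f j y \<partial>atomic (stick (\<lambda>k. W (fst i) (snd i) k \<omega>)) (\<lambda>n. \<xi> (fst i) (snd i) n \<omega>))
            - (\<integral>y. f j y \<partial>\<nu>\<^sub>0))\<^sup>2) \<partial>M (fst i) (snd i)) \<le> ennreal (4 * (C j)\<^sup>2 * r i))"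
      using ev
    proof eventually_elim
      case (elim i)
      interpret hierarchical_dirichlet_pos "M (fst i) (snd i)" "fst i" "snd i" \<nu>\<^sub>0
        "\<xi> (fst i) (snd i)" "U (fst i) (snd i)" "W (fst i) (snd i)" "\<Xi> (fst i) (snd i)"
        by (rule pos[OF elim])
      show ?case
        using atomic_W_second_moment[OF fm C] measurable_atomic_W r_nonneg[OF elim] prob_space_axioms
        unfolding r_def by blast
    qed
  qed simp
  show ?thesis
    using Z Xi At by (simp only: case_prod_unfold)
qed

end
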